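(* Let $\mathsf{BD}^{cf}$ be the constant-free fragment of $\mathsf{BD}$. There are exactly four extensions of $\mathsf{BD}^{cf}$ which are not the constant-free fragment of any extension of $\mathsf{BD}$, namely $\mathsf{LP}^-$, $(\mathsf{LP}\vee\mathsf{ECQ})^-$, $\mathsf{CL}^-$, and the almost trivial logic.
   Context: Formulas are built from a countably infinite set of variables using $\wedge,\vee$, ${\sim}$, $\top,\bot$; constant-free formulas are those not containing $\top,\bot$. A logic (in either signature) is a set of rules $\Gamma\vdash\varphi$ closed under reflexivity, monotonicity, cut and substitution; an extension of $L$ is a logic (in the same signature) containing $L$; $L_1\vee L_2$ is the least logic containing both. The constant-free fragment of a logic $L$ is the set of its rules in which only constant-free formulas occur. Let $\mathbf{DM}_4$ be the De Morgan algebra on $\{\bot,n,b,\top\}$ with $\bot<n,b<\top$ ($n,b$ incomparable), ${\sim}$ swapping $\top,\bot$ and fixing $n,b$; with validity meaning every valuation sending premises into the designated set sends the conclusion there: $\mathsf{BD}$ = rules valid in $\langle\mathbf{DM}_4,\{b,\top\}\rangle$, $\mathsf{LP}$ = rules valid in its submatrix on $\{\bot,b,\top\}$, $\mathsf{CL}$ = rules valid in $\langle\{\bot,\top\},\{\top\}\rangle$; $\mathsf{ECQ}$ = extension of $\mathsf{BD}$ by $p,{\sim}p\vdash q$. The almost trivial logic consists of all constant-free rules $\Gamma\vdash\varphi$ with $\Gamma\neq\emptyset$. For $L\in\{\mathsf{LP},\mathsf{LP}\vee\mathsf{ECQ},\mathsf{CL}\}$, $L^-$ is the constant-free logic in which $\Gamma\vdash\varphi$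 holds iff $\Gamma\ne\emptyset$ and $\Gamma\vdash\varphi$ is in the constant-free fragment of $L$ (i.e. the intersection of the almost trivial logic with the constant-free fragment of $L$). *)

theory Defs
  imports Main
begin

datatype fm =
    Var nat
  | Conj fm fm
  | Disj fm fm
  | Neg fm
  | Top
  | Bot

fun subst :: "(nat \<Rightarrow> fm) \<Rightarrow> fm \<Rightarrow> fm" where
  "subst \<sigma> (Var x) = \<sigma> x"
| "subst \<sigma> (Conj \<phi> \<psi>) = Conj (subst \<sigma> \<phi>) (subst \<sigma> \<psi>)"
| "subst \<sigma> (Disj \<phi> \<psi>) = Disj (subst \<sigma> \<phi>) (subst \<sigma> \<psi>)"
| "subst \<sigma> (Neg \<phi>) = Neg (subst \<sigma> \<phi>)"
| "subst \<sigma> Top = Top"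
| "subst \<sigma> Bot = Bot"

fun constant_free :: "fm \<Rightarrow> bool" where
  "constant_free (Var x) \<longleftrightarrow> True"
| "constant_free (Conj \<phi> \<psi>) \<longleftrightarrow> constant_free \<phi> \<and> constant_free \<psi>"
| "constant_free (Disj \<phi> \<psi>) \<longleftrightarrow> constant_free \<phi> \<and> constant_free \<psi>"
| "constant_free (Neg \<phi>) \<longleftrightarrow> constant_free \<phi>"
| "constant_free Top \<longleftrightarrow> False"
| "constant_free Bot \<longleftrightarrow> False"

text \<open>The two signatures are represented by their sets of formulas. Premise sets of rules
  may be infinite.\<close>

definition Fm :: "fm set" where
  "Fm = UNIV"

definition Fm_cf :: "fm set" where
  "Fm_cf = {\<phi>. constant_free \<phi>}"

type_synonym rule = "fm set \<times> fm"

definition is_logic :: "fm set \<Rightarrow> rule set \<Rightarrow> bool" where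
  "is_logic F L \<longleftrightarrow>
     L \<subseteq> Pow F \<times> F \<and>
     (\<forall>\<phi>\<in>F. ({\<phi>}, \<phi>) \<in> L) \<and>
     (\<forall>\<Gamma> \<Delta> \<phi>. (\<Gamma>, \<phi>) \<in> L \<longrightarrow> \<Delta> \<subseteq> F \<longrightarrow> (\<Gamma> \<union> \<Delta>, \<phi>) \<in> L) \<and>
     (\<forall>\<Gamma> \<Delta> \<phi>. (\<forall>\<delta>\<in>\<Delta>. (\<Gamma>, \<delta>) \<in> L) \<longrightarrow> (\<Gamma> \<union> \<Delta>, \<phi>) \<in> L \<longrightarrow> (\<Gamma>, \<phi>) \<in> L) \<and>
     (\<forall>\<sigma> \<Gamma> \<phi>. range \<sigma> \<subseteq> F \<longrightarrow> (\<Gamma>, \<phi>) \<in> L \<longrightarrow> (subst \<sigma> ` \<Gamma>, subst \<sigma> \<phi>) \<in> L)"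

definition is_extension :: "fm set \<Rightarrow> rule set \<Rightarrow> rule set \<Rightarrow> bool" where
  "is_extension F L L' \<longleftrightarrow> is_logic F L' \<and> L \<subseteq> L'"

definition least_logic :: "fm set \<Rightarrow> rule set \<Rightarrow> rule set" where
  "least_logic F R = \<Inter>{L. is_logic F L \<and> R \<subseteq> L}"

definition logic_join :: "fm set \<Rightarrow> rule set \<Rightarrow> rule set \<Rightarrow> rule set" where
  "logic_join F L\<^sub>1 L\<^sub>2 = least_logic F (L\<^sub>1 \<union> L\<^sub>2)"

definition cf_fragment :: "rule set \<Rightarrow> rule set" where
  "cf_fragment L = {(\<Gamma>, \<phi>). (\<Gamma>, \<phi>) \<in> L \<and> \<Gamma> \<subseteq> Fm_cf \<and> \<phi> \<in> Fm_cf}"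

datatype dm4 = DMbot | DMn | DMb | DMtop

instantiation dm4 :: bounded_lattice
begin

definition "(bot :: dm4) = DMbot"

definition "(top :: dm4) = DMtop"

definition "(x :: dm4) \<le> y \<longleftrightarrow> x = DMbot \<or> y = DMtop \<or> x = y"

definition "(x :: dm4) < y \<longleftrightarrow> x \<le> y \<and> x \<noteq> y"

definition "inf (x :: dm4) y = (if x \<le> y then x else if y \<le> x then y else DMbot)"

definition "sup (x :: dm4) y = (if x \<le> y then y else if y \<le> x then x else DMtop)"

instance
  by standard
    (auto simp: bot_dm4_def top_dm4_def less_eq_dm4_def less_dm4_def inf_dm4_def sup_dm4_def)

end

fun dm_neg :: "dm4 \<Rightarrow> dm4" where
  "dm_neg DMbot = DMtop"
| "dm_neg DMn = DMn"
| "dm_neg DMb = DMb"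
| "dm_neg DMtop = DMbot"

fun eval :: "(nat \<Rightarrow> dm4) \<Rightarrow> fm \<Rightarrow> dm4" where
  "eval v (Var x) = v x"
| "eval v (Conj \<phi> \<psi>) = inf (eval v \<phi>) (eval v \<psi>)"
| "eval v (Disj \<phi> \<psi>) = sup (eval v \<phi>) (eval v \<psi>)"
| "eval v (Neg \<phi>) = dm_neg (eval v \<phi>)"
| "eval v Top = top"
| "eval v Bot = bot"

text \<open>Rules valid in the matrix whose algebra is the subalgebra of the four-element De Morgan
  algebra with universe \<open>A\<close> and whose designated set is \<open>D\<close>.\<close>

definition valid_rules :: "dm4 set \<Rightarrow> dm4 set \<Rightarrow> rule set" where
  "valid_rules A D =
     {(\<Gamma>, \<phi>). \<forall>v. range v \<subseteq> A \<longrightarrow> (\<forall>\<gamma>\<in>\<Gamma>. eval v \<gamma> \<in> D) \<longrightarrow> eval v \<phi> \<in> D}"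

definition BD :: "rule set" where
  "BD = valid_rules UNIV {DMb, DMtop}"

definition LP :: "rule set" where
  "LP = valid_rules {DMbot, DMb, DMtop} {DMb, DMtop}"

definition CL :: "rule set" where
  "CL = valid_rules {DMbot, DMtop} {DMtop}"

definition ECQ :: "rule set" where
  "ECQ = least_logic Fm (BD \<union> {({Var 0, Neg (Var 0)}, Var 1)})"

definition almost_trivial :: "rule set" where
  "almost_trivial = {(\<Gamma>, \<phi>). \<Gamma> \<subseteq> Fm_cf \<and> \<phi> \<in> Fm_cf \<and> \<Gamma> \<noteq> {}}"

definition minus_logic :: "rule set \<Rightarrow> rule set" where
  "minus_logic L = almost_trivial \<inter> cf_fragment L"

end

theory Submission
  imports Defs
begin

text \<open>
  An extension \<open>L\<close> of the constant-free fragment of BD expands to a logic with constants as soon as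
  every formula that follows in \<open>L\<close> from each single formula is a theorem: a formula with constants
  is BD-equivalent to \<open>\<top>\<close>, to \<open>\<bottom>\<close> or to a constant-free formula, and instances of rules of \<open>L\<close> in
  which constants are substituted can be simulated by a cleverly chosen constant-free formula
  in the place of \<open>\<top>\<close>. This condition is also necessary, as one sees by substituting \<open>\<top>\<close> for a
  variable.

  If it fails, \<open>L\<close> has no theorems, but some formula follows from everything; collapsing its
  variables shows that \<open>p \<or> \<sim>p\<close> does so, hence \<open>L\<close> contains the minus logic of LP. Finally, any
  rule beyond LP yields explosion, any rule beyond \<open>LP \<or> ECQ\<close> yields disjunctive syllogism and
  thereby CL, and any rule beyond CL yields everything; each time, refuting valuations are turned
  into substitutions. Premise sets may be infinite, so compactness of classical logic is needed
  to see that explosion and disjunctive syllogism suffice.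
\<close>

section \<open>Consequence relations\<close>

lemma logic_closed: "is_logic F L \<Longrightarrow> (\<Gamma>, \<phi>) \<in> L \<Longrightarrow> \<Gamma> \<subseteq> F \<and> \<phi> \<in> F"
  unfolding is_logic_def by (elim conjE) (drule (1) subsetD, simp)

lemma logic_weaken: "is_logic F L \<Longrightarrow> (\<Gamma>, \<phi>) \<in> L \<Longrightarrow> \<Delta> \<subseteq> F \<Longrightarrow> (\<Gamma> \<union> \<Delta>, \<phi>) \<in> L"
  unfolding is_logic_def by (elim conjE) meson

lemma logic_cut_union:
  "is_logic F L \<Longrightarrow> \<forall>\<delta>\<in>\<Delta>. (\<Gamma>, \<delta>) \<in> L \<Longrightarrow> (\<Gamma> \<union> \<Delta>, \<phi>) \<in> L \<Longrightarrow> (\<Gamma>, \<phi>) \<in> L"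
  unfolding is_logic_def by (elim conjE) meson

lemma logic_mono:
  "is_logic F L \<Longrightarrow> (\<Gamma>, \<phi>) \<in> L \<Longrightarrow> \<Gamma> \<subseteq> \<Delta> \<Longrightarrow> \<Delta> \<subseteq> F \<Longrightarrow> (\<Delta>, \<phi>) \<in> L"
  using logic_weaken[of F L \<Gamma> \<phi> \<Delta>] by (simp add: sup.absorb2)

lemma logic_cut:
  assumes "is_logic F L" "\<Gamma> \<subseteq> F" "\<And>\<delta>. \<delta> \<in> \<Delta> \<Longrightarrow> (\<Gamma>, \<delta>) \<in> L" "(\<Delta>, \<phi>) \<in> L"
  shows "(\<Gamma>, \<phi>) \<in> L"
proof -
  have "(\<Gamma> \<union> \<Delta>, \<phi>) \<in> L" using logic_weaken[OF assms(1,4,2)] by (simp add: sup_commute)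
  thus ?thesis using logic_cut_union[OF assms(1)] assms(3) by blast
qed

lemma logic_refl:
  assumes "is_logic F L" "\<phi> \<in> \<Gamma>" "\<Gamma> \<subseteq> F"
  shows "(\<Gamma>, \<phi>) \<in> L"
proof -
  have "({\<phi>}, \<phi>) \<in> L" using assms unfolding is_logic_def by (elim conjE) (meson subsetD)
  thus ?thesis using logic_mono[OF assms(1)] assms(2,3) by simp
qed

lemma logic_subst:
  "is_logic F L \<Longrightarrow> (\<Gamma>, \<phi>) \<in> L \<Longrightarrow> range \<sigma> \<subseteq> F \<Longrightarrow> (subst \<sigma> ` \<Gamma>, subst \<sigma> \<phi>) \<in> L"
  unfolding is_logic_def by (elim conjE) meson

lemma is_logicI:
  assumes "\<And>\<Gamma> \<phi>. (\<Gamma>, \<phi>) \<in> L \<Longrightarrow> \<Gamma> \<subseteq> F \<and> \<phi> \<in> F"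
    and "\<And>\<phi>. \<phi> \<in> F \<Longrightarrow> ({\<phi>}, \<phi>) \<in> L"
    and "\<And>\<Gamma> \<Delta> \<phi>. (\<Gamma>, \<phi>) \<in> L \<Longrightarrow> \<Delta> \<subseteq> F \<Longrightarrow> (\<Gamma> \<union> \<Delta>, \<phi>) \<in> L"
    and "\<And>\<Gamma> \<Delta> \<phi>. (\<forall>\<delta>\<in>\<Delta>. (\<Gamma>, \<delta>) \<in> L) \<Longrightarrow> (\<Gamma> \<union> \<Delta>, \<phi>) \<in> L \<Longrightarrow> (\<Gamma>, \<phi>) \<in> L"
    and "\<And>\<sigma> \<Gamma> \<phi>. range \<sigma> \<subseteq> F \<Longrightarrow> (\<Gamma>, \<phi>) \<in> L \<Longrightarrow> (subst \<sigma> ` \<Gamma>, subst \<sigma> \<phi>) \<in> L"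
  shows "is_logic F L"
  unfolding is_logic_def
  apply (intro conjI)
  subgoal using assms(1) by auto
  subgoal by (intro ballI) (rule assms(2))
  subgoal by (intro allI impI) (rule assms(3))
  subgoal by (intro allI impI) (rule assms(4))
  subgoal by (intro allI impI) (rule assms(5))
  done

lemma is_logic_Inter:
  assumes "\<L> \<noteq> {}" "\<And>L. L \<in> \<L> \<Longrightarrow> is_logic F L"
  shows "is_logic F (\<Inter>\<L>)"
proof (rule is_logicI)
  show "\<Gamma> \<subseteq> F \<and> \<phi> \<in> F" if "(\<Gamma>, \<phi>) \<in> \<Inter>\<L>" for \<Gamma> \<phi>
    using that assms logic_closed by blast
  show "({\<phi>}, \<phi>) \<in> \<Inter>\<L>" if "\<phi> \<in> F" for \<phi>
    using that by (auto intro: logic_refl[OF assms(2)])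
  show "(\<Gamma> \<union> \<Delta>, \<phi>) \<in> \<Inter>\<L>" if "(\<Gamma>, \<phi>) \<in> \<Inter>\<L>" "\<Delta> \<subseteq> F" for \<Gamma> \<Delta> \<phi>
    using that by (auto intro: logic_weaken[OF assms(2)])
  show "(\<Gamma>, \<phi>) \<in> \<Inter>\<L>"
    if "\<forall>\<delta>\<in>\<Delta>. (\<Gamma>, \<delta>) \<in> \<Inter>\<L>" "(\<Gamma> \<union> \<Delta>, \<phi>) \<in> \<Inter>\<L>" for \<Gamma> \<Delta> \<phi>
  proof
    fix L assume L: "L \<in> \<L>"
    show "(\<Gamma>, \<phi>) \<in> L"
      by (rule logic_cut_union[OF assms(2)[OF L], of \<Delta>]) (use L that in blast)+
  qed
  show "(subst \<sigma> ` \<Gamma>, subst \<sigma> \<phi>) \<in> \<Inter>\<L>"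
    if "range \<sigma> \<subseteq> F" "(\<Gamma>, \<phi>) \<in> \<Inter>\<L>" for \<sigma> \<Gamma> \<phi>
    using that by (auto intro: logic_subst[OF assms(2)])
qed

lemma is_logic_Int: "is_logic F L \<Longrightarrow> is_logic F L' \<Longrightarrow> is_logic F (L \<inter> L')"
  using is_logic_Inter[of "{L, L'}" F] by auto

lemma is_logic_least_logic:
  assumes "R \<subseteq> Pow F \<times> F" "\<And>\<sigma> \<phi>. range \<sigma> \<subseteq> F \<Longrightarrow> \<phi> \<in> F \<Longrightarrow> subst \<sigma> \<phi> \<in> F"
  shows "is_logic F (least_logic F R)"
proof -
  \<comment> \<open>The set of all rules over \<open>F\<close> is a logic containing
    \<open>R\<close>, so the intersected family is nonempty.\<close>
  have "is_logic F (Pow F \<times> F)" by (rule is_logicI) (use assms(2) in auto)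
  thus ?thesis unfolding least_logic_def by (intro is_logic_Inter) (use assms(1) in auto)
qed

lemma is_logic_least_logic_Fm: "is_logic Fm (least_logic Fm R)"
  by (rule is_logic_least_logic) (auto simp: Fm_def)

lemma least_logic_upper: "R \<subseteq> least_logic F R"
  unfolding least_logic_def by blast

lemma least_logic_least: "is_logic F L \<Longrightarrow> R \<subseteq> L \<Longrightarrow> least_logic F R \<subseteq> L"
  unfolding least_logic_def by blast

lemma subst_constant_free:
  "constant_free \<phi> \<Longrightarrow> range \<sigma> \<subseteq> Fm_cf \<Longrightarrow> constant_free (subst \<sigma> \<phi>)"
  by (induction \<phi>) (auto simp: Fm_cf_def)

lemma is_logic_cf_fragment:
  assumes "is_logic Fm L"
  shows "is_logic Fm_cf (cf_fragment L)"
proof (rule is_logicI)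
  show "\<Gamma> \<subseteq> Fm_cf \<and> \<phi> \<in> Fm_cf" if "(\<Gamma>, \<phi>) \<in> cf_fragment L" for \<Gamma> \<phi>
    using that unfolding cf_fragment_def by blast
  show "({\<phi>}, \<phi>) \<in> cf_fragment L" if "\<phi> \<in> Fm_cf" for \<phi>
    using that logic_refl[OF assms, of \<phi> "{\<phi>}"] by (auto simp: cf_fragment_def Fm_def)
  show "(\<Gamma> \<union> \<Delta>, \<phi>) \<in> cf_fragment L" if "(\<Gamma>, \<phi>) \<in> cf_fragment L" "\<Delta> \<subseteq> Fm_cf" for \<Gamma> \<Delta> \<phi>
    using that logic_mono[OF assms, of \<Gamma> \<phi> "\<Gamma> \<union> \<Delta>"] by (auto simp: cf_fragment_def Fm_def)
  show "(\<Gamma>, \<phi>) \<in> cf_fragment L"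
    if "\<forall>\<delta>\<in>\<Delta>. (\<Gamma>, \<delta>) \<in> cf_fragment L" "(\<Gamma> \<union> \<Delta>, \<phi>) \<in> cf_fragment L" for \<Gamma> \<Delta> \<phi>
    using that logic_cut_union[OF assms, of \<Delta> \<Gamma> \<phi>] unfolding cf_fragment_def by blast
  show "(subst \<sigma> ` \<Gamma>, subst \<sigma> \<phi>) \<in> cf_fragment L"
    if "range \<sigma> \<subseteq> Fm_cf" "(\<Gamma>, \<phi>) \<in> cf_fragment L" for \<sigma> \<Gamma> \<phi>
    using that logic_subst[OF assms, of \<Gamma> \<phi> \<sigma>] subst_constant_free[OF _ that(1)]
    by (auto simp: cf_fragment_def Fm_def Fm_cf_def)
qed

lemma is_logic_almost_trivial: "is_logic Fm_cf almost_trivial"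
proof (rule is_logicI)
  show "(subst \<sigma> ` \<Gamma>, subst \<sigma> \<phi>) \<in> almost_trivial"
    if "range \<sigma> \<subseteq> Fm_cf" "(\<Gamma>, \<phi>) \<in> almost_trivial" for \<sigma> \<Gamma> \<phi>
    using that subst_constant_free[OF _ that(1)] by (auto simp: almost_trivial_def Fm_cf_def)
qed (auto simp: almost_trivial_def)

lemma is_logic_minus_logic: "is_logic Fm L \<Longrightarrow> is_logic Fm_cf (minus_logic L)"
  unfolding minus_logic_def
  by (intro is_logic_Int is_logic_almost_trivial is_logic_cf_fragment)

lemma minus_logic_iff:
  "(\<Gamma>, \<phi>) \<in> minus_logic L \<longleftrightarrow> \<Gamma> \<subseteq> Fm_cf \<and> \<phi> \<in> Fm_cf \<and> \<Gamma> \<noteq> {} \<and> (\<Gamma>, \<phi>) \<in> L"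
  unfolding minus_logic_def almost_trivial_def cf_fragment_def by auto

section \<open>Valuations\<close>

definition designated :: "dm4 \<Rightarrow> bool" where
  "designated a \<longleftrightarrow> a \<in> {DMb, DMtop}"

abbreviation gapless :: "(nat \<Rightarrow> dm4) \<Rightarrow> bool" where
  "gapless v \<equiv> range v \<subseteq> {DMbot, DMb, DMtop}"

abbreviation classical :: "(nat \<Rightarrow> dm4) \<Rightarrow> bool" where
  "classical v \<equiv> range v \<subseteq> {DMbot, DMtop}"

lemmas dm4_defs = inf_dm4_def sup_dm4_def less_eq_dm4_def top_dm4_def bot_dm4_def designated_def

lemma designated_inf: "designated (inf a b) \<longleftrightarrow> designated a \<and> designated b"
  by (cases a; cases b; simp add: dm4_defs)

lemma designated_sup: "designated (sup a b) \<longleftrightarrow> designated a \<or> designated b"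
  by (cases a; cases b; simp add: dm4_defs)

lemma dm_neg_simps:
  "dm_neg (dm_neg a) = a"
  "dm_neg (inf a b) = sup (dm_neg a) (dm_neg b)"
  "dm_neg (sup a b) = inf (dm_neg a) (dm_neg b)"
  by (cases a; cases b; simp add: dm4_defs)+

text \<open>A value is determined by whether it and its negation are designated, which presents the
  lattice as a product of the two-element chain with its dual. Inequalities thus unfold to
  propositional statements.\<close>

lemma dm4_le_iff:
  "a \<le> b \<longleftrightarrow> (designated a \<longrightarrow> designated b) \<and>
     (designated (dm_neg b) \<longrightarrow> designated (dm_neg a))"
  by (cases a; cases b; simp add: dm4_defs)

lemma designated_mono: "a \<le> b \<Longrightarrow> designated a \<Longrightarrow> designated b"
  by (auto simp: dm4_defs)

lemma eval_subst: "eval v (subst \<sigma> \<phi>) = eval (\<lambda>x. eval v (\<sigma> x)) \<phi>"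
  by (induction \<phi>) auto

lemma eval_gapless: "gapless v \<Longrightarrow> eval v \<phi> \<in> {DMbot, DMb, DMtop}"
  by (induction \<phi>) (auto simp: dm4_defs)

lemma eval_classical: "classical v \<Longrightarrow> eval v \<phi> \<in> {DMbot, DMtop}"
  by (induction \<phi>) (auto simp: dm4_defs)

text \<open>\<open>DMn\<close> and \<open>DMb\<close> are fixed by all connectives other than the
  constants. The all-\<open>DMn\<close> valuation refutes, and the all-\<open>DMb\<close> valuation
  satisfies, every constant-free formula.\<close>

lemma eval_const:
  assumes "constant_free \<phi>" "a \<in> {DMn, DMb}" "\<And>x. v x = a"
  shows "eval v \<phi> = a"
  using assms by (induction \<phi>) auto

text \<open>The information order: \<open>DMn\<close> at the bottom, \<open>DMb\<close> at the top,
  the two classical values incomparable in between. All connectives are monotone for it, and the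
  designated set is upward closed.\<close>

definition less_info :: "dm4 \<Rightarrow> dm4 \<Rightarrow> bool" where
  "less_info a b \<longleftrightarrow> a = DMn \<or> b = DMb \<or> a = b"

lemma less_info_refl: "less_info a a"
  by (simp add: less_info_def)

lemma less_info_inf: "less_info a a' \<Longrightarrow> less_info b b' \<Longrightarrow> less_info (inf a b) (inf a' b')"
  by (cases a; cases b; cases a'; cases b'; simp add: dm4_defs less_info_def)

lemma less_info_sup: "less_info a a' \<Longrightarrow> less_info b b' \<Longrightarrow> less_info (sup a b) (sup a' b')"
  by (cases a; cases b; cases a'; cases b'; simp add: dm4_defs less_info_def)

lemma less_info_neg: "less_info a a' \<Longrightarrow> less_info (dm_neg a) (dm_neg a')"
  by (cases a; cases a'; simp add: less_info_def)

lemma less_info_eval: "(\<And>x. less_info (v x) (w x)) \<Longrightarrow> less_info (eval v \<phi>) (eval w \<phi>)"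
  by (induction \<phi>) (auto intro: less_info_inf less_info_sup less_info_neg less_info_refl)

lemma designated_eval_mono:
  "(\<And>x. less_info (v x) (w x)) \<Longrightarrow> designated (eval v \<phi>) \<Longrightarrow> designated (eval w \<phi>)"
  using less_info_eval[of v w \<phi>] by (auto simp: less_info_def designated_def)

text \<open>Reading \<open>DMb\<close> as \<open>DMtop\<close> gives a classical valuation
  information-below \<open>v\<close>, and designation passes upwards. So classical tautologies hold
  in LP.\<close>

lemma gapless_of_classical_tautology:
  assumes "\<And>w. classical w \<Longrightarrow> designated (eval w \<phi>)" "gapless v"
  shows "designated (eval v \<phi>)"
proof -
  define w where "w = (\<lambda>x. if v x = DMb then DMtop else v x)"
  have "v x \<in> {DMbot, DMb, DMtop}" for x using assms(2) by blast
  hence "classical w" unfolding w_def by auto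
  moreover have "less_info (w x) (v x)" for x by (simp add: w_def less_info_def)
  ultimately show ?thesis using assms(1) designated_eval_mono by blast
qed

section \<open>Semantic descriptions of the logics\<close>

lemma BD_iff:
  "(\<Gamma>, \<phi>) \<in> BD \<longleftrightarrow> (\<forall>v. (\<forall>\<gamma>\<in>\<Gamma>. designated (eval v \<gamma>)) \<longrightarrow> designated (eval v \<phi>))"
  unfolding BD_def valid_rules_def designated_def by simp

lemma LP_iff:
  "(\<Gamma>, \<phi>) \<in> LP \<longleftrightarrow>
     (\<forall>v. gapless v \<longrightarrow> (\<forall>\<gamma>\<in>\<Gamma>. designated (eval v \<gamma>)) \<longrightarrow> designated (eval v \<phi>))"
  unfolding LP_def valid_rules_def designated_def by simp

lemma CL_iff:
  "(\<Gamma>, \<phi>) \<in> CL \<longleftrightarrow>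
     (\<forall>v. classical v \<longrightarrow> (\<forall>\<gamma>\<in>\<Gamma>. designated (eval v \<gamma>)) \<longrightarrow> designated (eval v \<phi>))"
proof -
  have "eval v \<psi> \<in> {DMtop} \<longleftrightarrow> designated (eval v \<psi>)" if "classical v" for v \<psi>
    using eval_classical[OF that, of \<psi>] by (auto simp: designated_def)
  thus ?thesis unfolding CL_def valid_rules_def by auto
qed

lemma is_logic_valid_rules:
  assumes "\<And>v \<phi>. range v \<subseteq> A \<Longrightarrow> eval v \<phi> \<in> A"
  shows "is_logic Fm (valid_rules A D)"
proof (rule is_logicI)
  show "(subst \<sigma> ` \<Gamma>, subst \<sigma> \<phi>) \<in> valid_rules A D"
    if "(\<Gamma>, \<phi>) \<in> valid_rules A D" for \<sigma> \<Gamma> \<phi>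
  proof -
    have "range (\<lambda>x. eval v (\<sigma> x)) \<subseteq> A" if "range v \<subseteq> A" for v
      using assms[OF that] by blast
    thus ?thesis using that unfolding valid_rules_def by (auto simp: eval_subst)
  qed
  show "(\<Gamma>, \<phi>) \<in> valid_rules A D"
    if "\<forall>\<delta>\<in>\<Delta>. (\<Gamma>, \<delta>) \<in> valid_rules A D" "(\<Gamma> \<union> \<Delta>, \<phi>) \<in> valid_rules A D" for \<Gamma> \<Delta> \<phi>
    using that unfolding valid_rules_def by blast
qed (auto simp: valid_rules_def Fm_def)

lemma is_logic_BD: "is_logic Fm BD"
  unfolding BD_def by (rule is_logic_valid_rules) simp

lemma is_logic_LP: "is_logic Fm LP"
  unfolding LP_def by (rule is_logic_valid_rules) (rule eval_gapless)

lemma is_logic_CL: "is_logic Fm CL"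
  unfolding CL_def by (rule is_logic_valid_rules) (rule eval_classical)

lemma is_logic_logic_join: "is_logic Fm (logic_join Fm L L')"
  unfolding logic_join_def by (rule is_logic_least_logic_Fm)

lemma BD_subset_LP: "BD \<subseteq> LP"
proof clarify
  fix \<Gamma> \<phi> assume "(\<Gamma>, \<phi>) \<in> BD"
  thus "(\<Gamma>, \<phi>) \<in> LP" unfolding BD_iff LP_iff by blast
qed

lemma LP_subset_CL: "LP \<subseteq> CL"
proof clarify
  fix \<Gamma> \<phi> assume "(\<Gamma>, \<phi>) \<in> LP"
  moreover have "gapless v" if "classical v" for v using that by auto
  ultimately show "(\<Gamma>, \<phi>) \<in> CL" unfolding CL_iff LP_iff by blast
qed

lemma cf_BD_memberI:
  "cf_fragment BD \<subseteq> L \<Longrightarrow> (\<Gamma>, \<phi>) \<in> BD \<Longrightarrow> \<Gamma> \<subseteq> Fm_cf \<Longrightarrow> \<phi> \<in> Fm_cf \<Longrightarrow> (\<Gamma>, \<phi>) \<in> L"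
  unfolding cf_fragment_def by blast

lemma cf_BD_subset_minus_logic:
  assumes "BD \<subseteq> L"
  shows "cf_fragment BD \<subseteq> minus_logic L"
proof -
  \<comment> \<open>No constant-free formula is a theorem of BD, since it takes the value
    \<open>DMn\<close> when all variables do. Hence every rule of the fragment has premises.\<close>
  have "({}, \<phi>) \<notin> BD" if "\<phi> \<in> Fm_cf" for \<phi>
    using that eval_const[of \<phi> DMn "\<lambda>_. DMn"] 
    by (auto simp: BD_iff Fm_cf_def designated_def intro!: exI[of _ "\<lambda>_. DMn"])
  thus ?thesis using assms by (auto simp: minus_logic_iff cf_fragment_def)
qed

section \<open>Compactness of classical logic\<close>

text \<open>The bound stands in for the finite set of variables of \<open>\<phi>\<close>. It serves
  compactness and later supplies a variable on which the value does not depend.\<close>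

lemma eval_finitely_determined:
  "\<exists>n. \<forall>v w. (\<forall>i<n. v i = w i) \<longrightarrow> eval v \<phi> = eval w \<phi>"
proof (induction \<phi>)
  case (Var x)
  show ?case by (rule exI[of _ "Suc x"]) simp
next
  case (Conj \<phi> \<psi>)
  then obtain m n where "\<And>v w. (\<forall>i<m. v i = w i) \<Longrightarrow> eval v \<phi> = eval w \<phi>"
    "\<And>v w. (\<forall>i<n. v i = w i) \<Longrightarrow> eval v \<psi> = eval w \<psi>" by blast
  thus ?case by (intro exI[of _ "max m n"]) 
      (metis eval.simps(2) max.strict_coboundedI1 max.strict_coboundedI2)
next
  case (Disj \<phi> \<psi>)
  then obtain m n where "\<And>v w. (\<forall>i<m. v i = w i) \<Longrightarrow> eval v \<phi> = eval w \<phi>"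
    "\<And>v w. (\<forall>i<n. v i = w i) \<Longrightarrow> eval v \<psi> = eval w \<psi>" by blast
  thus ?case by (intro exI[of _ "max m n"]) 
      (metis eval.simps(3) max.strict_coboundedI1 max.strict_coboundedI2)
next
  case (Neg \<phi>)
  thus ?case by (metis eval.simps(4))
qed auto

text \<open>A Koenig-style argument: the values of the variables are fixed one at a time, always so
  that every finite subset of \<open>\<Gamma>\<close> keeps a classical model with the values fixed
  so far.\<close>

lemma classical_compactness:
  assumes fin: "\<And>F. finite F \<Longrightarrow> F \<subseteq> \<Gamma> \<Longrightarrow> \<exists>v. classical v \<and> (\<forall>\<gamma>\<in>F. designated (eval v \<gamma>))"
  shows "\<exists>v. classical v \<and> (\<forall>\<gamma>\<in>\<Gamma>. designated (eval v \<gamma>))"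
proof -
  define good where "good = (\<lambda>n u. \<forall>F. finite F \<longrightarrow> F \<subseteq> \<Gamma> \<longrightarrow>
    (\<exists>v. classical v \<and> (\<forall>i<n. v i = u i) \<and> (\<forall>\<gamma>\<in>F. designated (eval v \<gamma>))))"
  have start: "\<exists>u. good 0 u" using fin unfolding good_def by simp
  have step: "\<exists>u'. good (Suc n) u' \<and> (\<forall>i<n. u' i = u i)" if g: "good n u" for n u
  proof (rule ccontr)
    assume no: "\<not> ?thesis"
    have bad: "\<exists>F. finite F \<and> F \<subseteq> \<Gamma> \<and>
        \<not> (\<exists>v. classical v \<and> (\<forall>i<n. v i = u i) \<and> v n = c \<and> (\<forall>\<gamma>\<in>F. designated (eval v \<gamma>)))" for c
    proof -
      have "\<not> good (Suc n) (u(n := c))" using no by auto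
      moreover have "(\<forall>i<Suc n. v i = (u(n := c)) i) \<longleftrightarrow> (\<forall>i<n. v i = u i) \<and> v n = c" for v
        by (auto simp: less_Suc_eq)
      ultimately show ?thesis unfolding good_def conj_assoc by meson
    qed
    \<comment> \<open>If neither value of variable \<open>n\<close> could be chosen, finite sets
      \<open>F\<close> and \<open>G\<close> would witness the two failures; a model of
      \<open>F \<union> G\<close> that agrees with \<open>u\<close> below \<open>n\<close>
      contradicts one of them.\<close>
    obtain F where F: "finite F" "F \<subseteq> \<Gamma>"
      "\<not> (\<exists>v. classical v \<and> (\<forall>i<n. v i = u i) \<and> v n = DMbot \<and> (\<forall>\<gamma>\<in>F. designated (eval v \<gamma>)))"
      using bad[of DMbot] by (elim exE conjE)
    obtain G where G: "finite G" "G \<subseteq> \<Gamma>"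
      "\<not> (\<exists>v. classical v \<and> (\<forall>i<n. v i = u i) \<and> v n = DMtop \<and> (\<forall>\<gamma>\<in>G. designated (eval v \<gamma>)))"
      using bad[of DMtop] by (elim exE conjE)
    have FG: "finite (F \<union> G)" "F \<union> G \<subseteq> \<Gamma>" using F(1,2) G(1,2) by simp_all
    obtain v where v: "classical v" "\<forall>i<n. v i = u i" "\<forall>\<gamma>\<in>F \<union> G. designated (eval v \<gamma>)"
      using g[unfolded good_def, rule_format, OF FG] by (elim exE conjE)
    have "v n = DMbot \<or> v n = DMtop" using v(1) by auto
    thus False
    proof
      assume "v n = DMbot"
      thus False using v by - (rule notE[OF F(3)], rule exI[of _ v], simp add: ball_Un)
    next
      assume "v n = DMtop"
      thus False using v by - (rule notE[OF G(3)], rule exI[of _ v], simp add: ball_Un)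
    qed
  qed
  obtain f where f: "\<And>n. good n (f n)" "\<And>n i. i < n \<Longrightarrow> f (Suc n) i = f n i"
    using dependent_nat_choice[of good "\<lambda>n u u'. \<forall>i<n. u' i = u i"] start step by metis
  \<comment> \<open>The diagonal limit: once fixed, the value of a variable never changes, so
    \<open>u\<close> agrees with each \<open>f n\<close> below \<open>n\<close>.\<close>
  define u where "u = (\<lambda>i. f (Suc i) i)"
  have agree: "f n i = u i" if "i < n" for n i
    using that
  proof (induction n)
    case (Suc n)
    thus ?case by (cases "i = n") (auto simp: u_def f(2))
  qed simp
  have "u i \<in> {DMbot, DMtop}" for i
  proof -
    obtain v where "classical v" "\<forall>j<Suc i. v j = f (Suc i) j"
      using f(1)[of "Suc i"] unfolding good_def by (meson empty_subsetI finite.emptyI)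
    thus ?thesis unfolding u_def by (metis lessI rangeI subsetD)
  qed
  moreover have "designated (eval u \<gamma>)" if "\<gamma> \<in> \<Gamma>" for \<gamma>
  proof -
    obtain n where n: "\<And>v w. (\<forall>i<n. v i = w i) \<Longrightarrow> eval v \<gamma> = eval w \<gamma>"
      using eval_finitely_determined by meson
    have "finite {\<gamma>}" "{\<gamma>} \<subseteq> \<Gamma>" using that by auto
    then obtain v where "\<forall>i<n. v i = f n i" "designated (eval v \<gamma>)"
      using f(1)[of n] unfolding good_def by (metis singletonI)
    thus ?thesis using n[of v u] agree by simp
  qed
  ultimately show ?thesis by blast
qed

lemma conjunction_exists:
  assumes "finite F" "F \<noteq> {}" "F \<subseteq> Fm_cf"
  shows "\<exists>\<gamma>\<in>Fm_cf. \<forall>v. designated (eval v \<gamma>) \<longleftrightarrow> (\<forall>\<delta>\<in>F. designated (eval v \<delta>))"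
  using assms
proof (induction F rule: finite_ne_induct)
  case (singleton \<delta>)
  thus ?case by blast
next
  case (insert \<delta> F)
  then obtain \<gamma> where "\<gamma> \<in> Fm_cf"
    "\<forall>v. designated (eval v \<gamma>) \<longleftrightarrow> (\<forall>\<delta>\<in>F. designated (eval v \<delta>))" by blast
  thus ?case using insert.prems
    by (intro bexI[of _ "Conj \<delta> \<gamma>"]) (simp_all only: eval.simps designated_inf Fm_cf_def, auto)
qed

text \<open>Compactness turns an infinite premise set into a single formula, the conjunction of
  finitely many premises. The conclusion may contain constants, since \<open>Bot\<close> will
  express unsatisfiability.\<close>

lemma CL_finite_premise:
  assumes "(\<Gamma>, \<phi>) \<in> CL" "\<Gamma> \<subseteq> Fm_cf" "\<Gamma> \<noteq> {}"
  obtains \<gamma> where "\<gamma> \<in> Fm_cf" "(\<Gamma>, \<gamma>) \<in> BD" "({\<gamma>}, \<phi>) \<in> CL"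
proof -
  have neg: "designated (eval v (Neg \<phi>)) \<longleftrightarrow> \<not> designated (eval v \<phi>)" if "classical v" for v
    using eval_classical[OF that, of \<phi>] by (auto simp: designated_def)
  define sat where "sat = (\<lambda>F. \<exists>v. classical v \<and> (\<forall>\<gamma>\<in>F. designated (eval v \<gamma>)))"
  have "sat \<Delta>" if "\<And>F. finite F \<Longrightarrow> F \<subseteq> \<Delta> \<Longrightarrow> sat F" for \<Delta>
    using that unfolding sat_def by (rule classical_compactness)
  moreover have "\<not> sat (insert (Neg \<phi>) \<Gamma>)" using assms(1) neg unfolding CL_iff sat_def
    by (metis insert_iff)
  ultimately obtain F where F: "finite F" "F \<subseteq> insert (Neg \<phi>) \<Gamma>" "\<not> sat F" by blast
  obtain \<gamma>\<^sub>0 where "\<gamma>\<^sub>0 \<in> \<Gamma>" using assms(3) by blast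
  \<comment> \<open>A premise is put in so that the conjunction is nonempty, as an empty one would
    be \<open>Top\<close>.\<close>
  define G where "G = insert \<gamma>\<^sub>0 (F - {Neg \<phi>})"
  have G: "finite G" "G \<noteq> {}" "G \<subseteq> \<Gamma>" using F(1,2) \<open>\<gamma>\<^sub>0 \<in> \<Gamma>\<close> unfolding G_def by auto
  then obtain \<gamma> where \<gamma>: "\<gamma> \<in> Fm_cf"
    "\<And>v. designated (eval v \<gamma>) \<longleftrightarrow> (\<forall>\<delta>\<in>G. designated (eval v \<delta>))"
    using conjunction_exists[of G] assms(2) by blast
  have "(\<Gamma>, \<gamma>) \<in> BD" unfolding BD_iff \<gamma>(2) using G(3) by blast
  moreover have "({\<gamma>}, \<phi>) \<in> CL"
    unfolding CL_iff
  proof (intro allI impI)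
    fix v assume v: "classical v" "\<forall>\<gamma>\<in>{\<gamma>}. designated (eval v \<gamma>)"
    hence "\<forall>\<delta>\<in>G. designated (eval v \<delta>)" using \<gamma>(2) by blast
    moreover obtain \<delta> where "\<delta> \<in> F" "\<not> designated (eval v \<delta>)"
      using F(3) v(1) unfolding sat_def by blast
    ultimately show "designated (eval v \<phi>)" using neg[OF v(1)] unfolding G_def by blast
  qed
  ultimately show ?thesis using that \<gamma>(1) by blast
qed

section \<open>Eliminating the constants\<close>

fun reduce :: "fm \<Rightarrow> fm" where
  "reduce (Var x) = Var x"
| "reduce (Conj \<phi> \<psi>) =
     (if reduce \<phi> = Bot \<or> reduce \<psi> = Bot then Bot
      else if reduce \<phi> = Top then reduce \<psi>
      else if reduce \<psi> = Top then reduce \<phi>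
      else Conj (reduce \<phi>) (reduce \<psi>))"
| "reduce (Disj \<phi> \<psi>) =
     (if reduce \<phi> = Top \<or> reduce \<psi> = Top then Top
      else if reduce \<phi> = Bot then reduce \<psi>
      else if reduce \<psi> = Bot then reduce \<phi>
      else Disj (reduce \<phi>) (reduce \<psi>))"
| "reduce (Neg \<phi>) =
     (if reduce \<phi> = Top then Bot else if reduce \<phi> = Bot then Top else Neg (reduce \<phi>))"
| "reduce Top = Top"
| "reduce Bot = Bot"

lemma dm_neg_top_bot: "dm_neg top = bot" "dm_neg bot = top"
  by (simp_all add: dm4_defs)

lemma eval_reduce: "eval v (reduce \<phi>) = eval v \<phi>"
proof (induction \<phi>)
  case (Conj \<phi> \<psi>)
  thus ?case by (auto simp flip: Conj.IH)
next
  case (Disj \<phi> \<psi>)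
  thus ?case by (auto simp flip: Disj.IH)
next
  case (Neg \<phi>)
  thus ?case by (auto simp: dm_neg_top_bot simp flip: Neg.IH)
qed simp_all

lemma reduce_constant_free_or_constant: "reduce \<phi> \<in> {Top, Bot} \<union> Fm_cf"
  by (induction \<phi>) (auto simp: Fm_cf_def)

lemma reduce_constant_free: "constant_free \<phi> \<Longrightarrow> reduce \<phi> = \<phi>"
proof (induction \<phi>)
  case (Conj \<phi> \<psi>)
  hence "\<phi> \<notin> {Top, Bot}" "\<psi> \<notin> {Top, Bot}" by auto
  thus ?case using Conj by simp
next
  case (Disj \<phi> \<psi>)
  hence "\<phi> \<notin> {Top, Bot}" "\<psi> \<notin> {Top, Bot}" by auto
  thus ?case using Disj by simp
next
  case (Neg \<phi>)
  hence "\<phi> \<notin> {Top, Bot}" by auto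
  thus ?case using Neg by simp
qed simp_all

text \<open>Entailment between reduced formulas: premises \<open>Top\<close> are dropped, and a
  conclusion \<open>Bot\<close> is read as entailing every constant-free formula. Membership in
  \<open>{Bot, \<psi>}\<close> treats that case together with a constant-free conclusion.\<close>

definition reduced_entails :: "rule set \<Rightarrow> fm set \<Rightarrow> fm \<Rightarrow> bool" where
  "reduced_entails L \<Gamma> \<phi> \<longleftrightarrow>
     reduce \<phi> = Top \<or> Bot \<in> reduce ` \<Gamma> \<or>
     (\<forall>\<psi>\<in>Fm_cf. reduce \<phi> \<in> {Bot, \<psi>} \<longrightarrow> (reduce ` \<Gamma> - {Top}, \<psi>) \<in> L)"

text \<open>Quantifying over all substitutions makes this closed under substitution; already for
  BD itself, the infinite set of all literals entails every constant-free formula without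
  entailing \<open>\<bottom>\<close>.\<close>

definition constant_expansion :: "rule set \<Rightarrow> rule set" where
  "constant_expansion L = {(\<Gamma>, \<phi>). \<forall>\<sigma>. reduced_entails L (subst \<sigma> ` \<Gamma>) (subst \<sigma> \<phi>)}"

lemma reduce_image_cf:
  assumes "Bot \<notin> reduce ` \<Gamma>"
  shows "reduce ` \<Gamma> - {Top} \<subseteq> Fm_cf"
proof
  fix \<psi> assume \<psi>: "\<psi> \<in> reduce ` \<Gamma> - {Top}"
  hence "\<psi> \<noteq> Bot" using assms by blast
  thus "\<psi> \<in> Fm_cf" using \<psi> reduce_constant_free_or_constant by auto
qed

lemma reduced_entails_refl:
  assumes "is_logic Fm_cf L"
  shows "reduced_entails L {\<phi>} \<phi>"
  using reduce_constant_free_or_constant[of \<phi>]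
  by (auto simp: reduced_entails_def Fm_cf_def intro!: logic_refl[OF assms])

lemma reduced_entails_mono:
  assumes "is_logic Fm_cf L" "reduced_entails L \<Gamma> \<phi>" "\<Gamma> \<subseteq> \<Delta>"
  shows "reduced_entails L \<Delta> \<phi>"
proof (cases "reduce \<phi> = Top \<or> Bot \<in> reduce ` \<Delta>")
  case False
  moreover from this have "Bot \<notin> reduce ` \<Gamma>" using assms(3) by blast
  ultimately have "(reduce ` \<Gamma> - {Top}, \<psi>) \<in> L" if "\<psi> \<in> Fm_cf" "reduce \<phi> \<in> {Bot, \<psi>}" for \<psi>
    using assms(2) that unfolding reduced_entails_def by blast
  moreover have "reduce ` \<Gamma> - {Top} \<subseteq> reduce ` \<Delta> - {Top}" using assms(3) by blast
  moreover have "reduce ` \<Delta> - {Top} \<subseteq> Fm_cf" by (rule reduce_image_cf) (use False in blast)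
  ultimately have "(reduce ` \<Delta> - {Top}, \<psi>) \<in> L" if "\<psi> \<in> Fm_cf" "reduce \<phi> \<in> {Bot, \<psi>}" for \<psi>
    using that logic_mono[OF assms(1)] by metis
  thus ?thesis unfolding reduced_entails_def by blast
qed (auto simp: reduced_entails_def)

lemma reduced_entails_cut:
  assumes L: "is_logic Fm_cf L" and \<Delta>: "\<And>\<delta>. \<delta> \<in> \<Delta> \<Longrightarrow> reduced_entails L \<Gamma> \<delta>"
    and \<phi>: "reduced_entails L (\<Gamma> \<union> \<Delta>) \<phi>"
  shows "reduced_entails L \<Gamma> \<phi>"
proof (cases "reduce \<phi> = Top \<or> Bot \<in> reduce ` \<Gamma>")
  case False
  have "(reduce ` \<Gamma> - {Top}, \<psi>) \<in> L" if \<psi>: "\<psi> \<in> Fm_cf" "reduce \<phi> \<in> {Bot, \<psi>}" for \<psi>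
  proof (cases "Bot \<in> reduce ` \<Delta>")
    case True
    \<comment> \<open>Here \<open>\<Gamma>\<close> entails a formula that reduces to
      \<open>Bot\<close>, so it already entails every constant-free formula.\<close>
    then obtain \<delta> where "\<delta> \<in> \<Delta>" "reduce \<delta> = Bot" by auto
    thus ?thesis using \<Delta>[of \<delta>] \<psi> False by (auto simp: reduced_entails_def)
  next
    case noBot: False
    show ?thesis
    proof (rule logic_cut[OF L reduce_image_cf])
      show "Bot \<notin> reduce ` \<Gamma>" using False by blast
      show "(reduce ` (\<Gamma> \<union> \<Delta>) - {Top}, \<psi>) \<in> L"
        using \<phi> \<psi> False noBot by (auto simp: reduced_entails_def)
      fix \<theta> assume \<theta>: "\<theta> \<in> reduce ` (\<Gamma> \<union> \<Delta>) - {Top}"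
      show "(reduce ` \<Gamma> - {Top}, \<theta>) \<in> L"
      proof (cases "\<theta> \<in> reduce ` \<Gamma>")
        case True
        thus ?thesis using \<theta> False by (intro logic_refl[OF L] reduce_image_cf) auto
      next
        case notin: False
        then obtain \<delta> where \<delta>: "\<delta> \<in> \<Delta>" "\<theta> = reduce \<delta>" using \<theta> by blast
        hence "\<theta> \<noteq> Bot" using noBot by blast
        hence "\<theta> \<in> Fm_cf" using \<theta> \<delta> reduce_constant_free_or_constant[of \<delta>] by auto
        thus ?thesis using \<Delta>[OF \<delta>(1)] \<delta> \<theta> False by (auto simp: reduced_entails_def)
      qed
    qed
  qed
  thus ?thesis unfolding reduced_entails_def by blast
qed (auto simp: reduced_entails_def)

lemma subst_subst: "subst \<sigma> (subst \<tau> \<phi>) = subst (\<lambda>x. subst \<sigma> (\<tau> x)) \<phi>"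
  by (induction \<phi>) auto

lemma subst_Var: "subst Var \<phi> = \<phi>"
  by (induction \<phi>) auto

lemma is_logic_constant_expansion:
  assumes L: "is_logic Fm_cf L"
  shows "is_logic Fm (constant_expansion L)"
proof (rule is_logicI)
  show "({\<phi>}, \<phi>) \<in> constant_expansion L" for \<phi>
    using reduced_entails_refl[OF L] by (simp add: constant_expansion_def)
  show "(\<Gamma> \<union> \<Delta>, \<phi>) \<in> constant_expansion L" if "(\<Gamma>, \<phi>) \<in> constant_expansion L" for \<Gamma> \<Delta> \<phi>
    using that by (auto simp: constant_expansion_def image_Un intro: reduced_entails_mono[OF L])
  show "(\<Gamma>, \<phi>) \<in> constant_expansion L"
    if "\<forall>\<delta>\<in>\<Delta>. (\<Gamma>, \<delta>) \<in> constant_expansion L" "(\<Gamma> \<union> \<Delta>, \<phi>) \<in> constant_expansion L" for \<Gamma> \<Delta> \<phi>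
  proof -
    have "reduced_entails L (subst \<sigma> ` \<Gamma>) (subst \<sigma> \<phi>)" for \<sigma>
      by (rule reduced_entails_cut[OF L, of "subst \<sigma> ` \<Delta>"])
        (use that in \<open>auto simp: constant_expansion_def image_Un\<close>)
    thus ?thesis by (simp add: constant_expansion_def)
  qed
  show "(subst \<sigma> ` \<Gamma>, subst \<sigma> \<phi>) \<in> constant_expansion L"
    if "(\<Gamma>, \<phi>) \<in> constant_expansion L" for \<sigma> \<Gamma> \<phi>
    using that by (simp add: constant_expansion_def image_image subst_subst)
qed (simp add: Fm_def)

lemma BD_subset_constant_expansion:
  assumes "cf_fragment BD \<subseteq> L"
  shows "BD \<subseteq> constant_expansion L"
proof -
  have red: "reduced_entails L \<Gamma> \<phi>" if BD: "(\<Gamma>, \<phi>) \<in> BD" for \<Gamma> \<phi>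
  proof (cases "reduce \<phi> = Top \<or> Bot \<in> reduce ` \<Gamma>")
    case False
    have \<Gamma>: "reduce ` \<Gamma> - {Top} \<subseteq> Fm_cf" using False by (intro reduce_image_cf) blast
    have sat: "designated (eval v (reduce \<phi>))"
      if v: "\<forall>\<gamma>\<in>reduce ` \<Gamma> - {Top}. designated (eval v \<gamma>)" for v
    proof -
      have "designated (eval v \<gamma>)" if "\<gamma> \<in> \<Gamma>" for \<gamma>
      proof (cases "reduce \<gamma> = Top")
        case True
        thus ?thesis using eval_reduce[of v \<gamma>] by (simp add: dm4_defs)
      next
        case False
        hence "designated (eval v (reduce \<gamma>))" using v that by blast
        thus ?thesis unfolding eval_reduce .
      qed
      hence "designated (eval v \<phi>)" using BD unfolding BD_iff by blast
      thus ?thesis unfolding eval_reduce .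
    qed
    \<comment> \<open>The reduced premises are constant-free, so the all-\<open>DMb\<close>
      valuation satisfies them; a conclusion \<open>Bot\<close> would fail there.\<close>
    have "designated (eval (\<lambda>_. DMb) (reduce \<phi>))"
      using \<Gamma> eval_const[of _ DMb "\<lambda>_. DMb"] by (intro sat) (auto simp: Fm_cf_def designated_def)
    hence "reduce \<phi> \<noteq> Bot" by (auto simp: dm4_defs)
    moreover have "(reduce ` \<Gamma> - {Top}, reduce \<phi>) \<in> BD" unfolding BD_iff using sat by blast
    ultimately show ?thesis using assms \<Gamma> by (auto simp: reduced_entails_def cf_fragment_def)
  qed (auto simp: reduced_entails_def)
  show ?thesis
  proof clarify
    fix \<Gamma> \<phi> assume "(\<Gamma>, \<phi>) \<in> BD"
    hence "(subst \<sigma> ` \<Gamma>, subst \<sigma> \<phi>) \<in> BD" for \<sigma>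
      by (rule logic_subst[OF is_logic_BD]) (simp add: Fm_def)
    thus "(\<Gamma>, \<phi>) \<in> constant_expansion L" using red by (simp add: constant_expansion_def)
  qed
qed

section \<open>Interpreting the constants by a constant-free formula\<close>

definition constants_to :: "fm \<Rightarrow> (nat \<Rightarrow> fm) \<Rightarrow> nat \<Rightarrow> fm" where
  "constants_to \<theta> \<sigma> x =
     (if reduce (\<sigma> x) = Top then \<theta> else if reduce (\<sigma> x) = Bot then Neg \<theta> else reduce (\<sigma> x))"

lemma constants_to_cf: "\<theta> \<in> Fm_cf \<Longrightarrow> range (constants_to \<theta> \<sigma>) \<subseteq> Fm_cf"
  using reduce_constant_free_or_constant by (auto simp: constants_to_def Fm_cf_def)

text \<open>The hypotheses say that \<open>c\<close> and \<open>d\<close> approximate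
  \<open>a\<close> and \<open>b\<close>: from below after meeting with \<open>t\<close>, from above
  after joining with \<open>dm_neg t\<close>. In terms of designation, preservation is
  propositional.\<close>

lemma constants_to_bounds_inf:
  fixes a b c d t :: dm4
  assumes "inf a t \<le> c" "c \<le> sup a (dm_neg t)" "inf b t \<le> d" "d \<le> sup b (dm_neg t)"
  shows "inf (inf a b) t \<le> inf c d \<and> inf c d \<le> sup (inf a b) (dm_neg t)"
  using assms unfolding dm4_le_iff dm_neg_simps designated_inf designated_sup by blast

lemma constants_to_bounds_sup:
  fixes a b c d t :: dm4
  assumes "inf a t \<le> c" "c \<le> sup a (dm_neg t)" "inf b t \<le> d" "d \<le> sup b (dm_neg t)"
  shows "inf (sup a b) t \<le> sup c d \<and> sup c d \<le> sup (sup a b) (dm_neg t)"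
  using assms unfolding dm4_le_iff dm_neg_simps designated_inf designated_sup by blast

lemma constants_to_bounds_neg:
  fixes a c t :: dm4
  assumes "inf a t \<le> c" "c \<le> sup a (dm_neg t)"
  shows "inf (dm_neg a) t \<le> dm_neg c \<and> dm_neg c \<le> sup (dm_neg a) (dm_neg t)"
  using assms unfolding dm4_le_iff dm_neg_simps designated_inf designated_sup by blast

text \<open>Replacing the constants changes values only within bounds controlled by
  \<open>\<theta>\<close>, which are tight where \<open>\<theta>\<close> has the value
  \<open>DMtop\<close>. They are checked at the variables and preserved by the connectives.\<close>

lemma eval_constants_to:
  assumes "constant_free \<phi>"
  shows "inf (eval v (subst \<sigma> \<phi>)) (eval v \<theta>) \<le> eval v (subst (constants_to \<theta> \<sigma>) \<phi>) \<and>
    eval v (subst (constants_to \<theta> \<sigma>) \<phi>) \<le> sup (eval v (subst \<sigma> \<phi>)) (dm_neg (eval v \<theta>))"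
  using assms
proof (induction \<phi>)
  case (Var x)
  show ?case
    using eval_reduce[of v "\<sigma> x"] by (auto simp: constants_to_def)
next
  case (Conj \<phi> \<psi>)
  thus ?case unfolding subst.simps eval.simps by (intro constants_to_bounds_inf) auto
next
  case (Disj \<phi> \<psi>)
  thus ?case unfolding subst.simps eval.simps by (intro constants_to_bounds_sup) auto
next
  case (Neg \<phi>)
  thus ?case unfolding subst.simps eval.simps by (intro constants_to_bounds_neg) auto
qed simp_all

lemma bounds_collapse:
  fixes a b c :: dm4
  assumes "a \<le> b" "c \<le> sup a (dm_neg (sup d (dm_neg b)))"
  shows "c \<le> b"
  using assms unfolding dm4_le_iff dm_neg_simps designated_inf designated_sup by blast

text \<open>Interpreting \<open>\<top>\<close> by \<open>\<theta> = \<gamma> \<or> \<sim>\<psi>\<close> and \<open>\<bottom>\<close> by \<open>\<sim>\<theta>\<close> costs nothing: the premise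
  \<open>\<gamma>\<close> yields \<open>\<theta>\<close>, and the error term \<open>\<sim>\<theta> = \<sim>\<gamma> \<and> \<psi>\<close> in the conclusion is below \<open>\<psi>\<close>.\<close>

lemma reduced_subst_derivable:
  assumes L: "is_logic Fm_cf L" and ext: "cf_fragment BD \<subseteq> L" and rule: "(\<Gamma>, \<phi>) \<in> L"
    and noBot: "Bot \<notin> reduce ` subst \<sigma> ` \<Gamma>"
    and \<psi>: "\<psi> \<in> Fm_cf" "reduce (subst \<sigma> \<phi>) \<in> {Bot, \<psi>}" and \<gamma>: "\<gamma> \<in> Fm_cf"
  shows "(insert \<gamma> (reduce ` subst \<sigma> ` \<Gamma> - {Top}), \<psi>) \<in> L"
proof -
  define \<theta> where "\<theta> = Disj \<gamma> (Neg \<psi>)"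
  define \<tau> where "\<tau> = constants_to \<theta> \<sigma>"
  define \<Delta> where "\<Delta> = insert \<gamma> (reduce ` subst \<sigma> ` \<Gamma> - {Top})"
  have \<theta>: "\<theta> \<in> Fm_cf" using \<gamma> \<psi> by (simp add: \<theta>_def Fm_cf_def)
  have cf: "\<Gamma> \<subseteq> Fm_cf" "\<phi> \<in> Fm_cf" using logic_closed[OF L rule] by auto
  have \<tau>: "range \<tau> \<subseteq> Fm_cf" unfolding \<tau>_def by (rule constants_to_cf[OF \<theta>])
  have \<tau>cf: "subst \<tau> \<chi> \<in> Fm_cf" if "\<chi> \<in> Fm_cf" for \<chi>
    using that subst_constant_free[OF _ \<tau>] by (simp add: Fm_cf_def)
  have \<Delta>: "\<Delta> \<subseteq> Fm_cf" unfolding \<Delta>_def using \<gamma> reduce_image_cf[OF noBot] by blast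
  \<comment> \<open>Under \<open>\<Delta>\<close> both \<open>\<theta>\<close> and the
    \<open>\<sigma>\<close>-instance of the premise are designated, so the lower bound makes the
    \<open>\<tau>\<close>-instance designated.\<close>
  have prem: "(\<Delta>, subst \<tau> \<chi>) \<in> BD" if "\<chi> \<in> \<Gamma>" for \<chi>
    unfolding BD_iff
  proof (intro allI impI)
    fix v assume v: "\<forall>\<gamma>\<in>\<Delta>. designated (eval v \<gamma>)"
    hence "designated (eval v \<theta>)" unfolding \<theta>_def \<Delta>_def eval.simps designated_sup by blast
    moreover have "designated (eval v (subst \<sigma> \<chi>))"
    proof (cases "reduce (subst \<sigma> \<chi>) = Top")
      case True
      thus ?thesis using eval_reduce[of v "subst \<sigma> \<chi>"] by (simp add: dm4_defs)
    next
      case False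
      hence "designated (eval v (reduce (subst \<sigma> \<chi>)))" using v that unfolding \<Delta>_def by blast
      thus ?thesis unfolding eval_reduce .
    qed
    ultimately have "designated (inf (eval v (subst \<sigma> \<chi>)) (eval v \<theta>))"
      unfolding designated_inf by blast
    thus "designated (eval v (subst \<tau> \<chi>))"
      using eval_constants_to[of \<chi> v \<sigma> \<theta>] that cf designated_mono
      unfolding \<tau>_def Fm_cf_def by blast
  qed
  have \<Delta>\<phi>: "(\<Delta>, subst \<tau> \<phi>) \<in> L"
  proof (rule logic_cut[OF L \<Delta>])
    show "(subst \<tau> ` \<Gamma>, subst \<tau> \<phi>) \<in> L" by (rule logic_subst[OF L rule \<tau>])
    show "(\<Delta>, \<delta>) \<in> L" if "\<delta> \<in> subst \<tau> ` \<Gamma>" for \<delta>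
      using that prem \<Delta> \<tau>cf cf by (auto intro!: cf_BD_memberI[OF ext])
  qed
  have "({subst \<tau> \<phi>}, \<psi>) \<in> BD"
  proof -
    have "eval v (subst \<tau> \<phi>) \<le> eval v \<psi>" for v
    proof (rule bounds_collapse)
      show "eval v (subst \<sigma> \<phi>) \<le> eval v \<psi>" using \<psi>(2) eval_reduce[of v "subst \<sigma> \<phi>"] by auto
      show "eval v (subst \<tau> \<phi>) \<le>
          sup (eval v (subst \<sigma> \<phi>)) (dm_neg (sup (eval v \<gamma>) (dm_neg (eval v \<psi>))))"
        using eval_constants_to[of \<phi> v \<sigma> \<theta>] cf by (simp add: Fm_cf_def \<tau>_def \<theta>_def)
    qed
    thus ?thesis unfolding BD_iff using designated_mono by blast
  qed
  hence \<phi>\<psi>: "({subst \<tau> \<phi>}, \<psi>) \<in> L" using ext \<tau>cf[OF cf(2)] \<psi>(1) by (auto simp: cf_fragment_def)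
  have "(\<Delta>, \<psi>) \<in> L" by (rule logic_cut[OF L \<Delta> _ \<phi>\<psi>]) (simp add: \<Delta>\<phi>)
  thus ?thesis unfolding \<Delta>_def .
qed

text \<open>An instance whose premises all reduce to \<open>Top\<close> must hold with no premise
  left. The auxiliary \<open>\<gamma>\<close> is then arbitrary, and \<open>theorems\<close> removes
  it; otherwise a remaining premise serves as \<open>\<gamma>\<close>.\<close>

lemma cf_fragment_constant_expansion:
  assumes L: "is_logic Fm_cf L" and ext: "cf_fragment BD \<subseteq> L"
    and theorems: "\<And>\<psi>. \<psi> \<in> Fm_cf \<Longrightarrow> (\<And>\<gamma>. \<gamma> \<in> Fm_cf \<Longrightarrow> ({\<gamma>}, \<psi>) \<in> L) \<Longrightarrow> ({}, \<psi>) \<in> L"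
  shows "cf_fragment (constant_expansion L) = L"
proof (intro equalityI subsetI; clarify)
  fix \<Gamma> \<phi> assume "(\<Gamma>, \<phi>) \<in> cf_fragment (constant_expansion L)"
  \<comment> \<open>The identity substitution suffices, as reduction leaves constant-free formulas
    unchanged.\<close>
  hence cf: "\<Gamma> \<subseteq> Fm_cf" "\<phi> \<in> Fm_cf" and red: "reduced_entails L (subst Var ` \<Gamma>) (subst Var \<phi>)"
    unfolding cf_fragment_def constant_expansion_def by blast+
  have "reduce ` \<Gamma> = \<Gamma>" "reduce \<phi> = \<phi>"
    using cf reduce_constant_free by (force simp: Fm_cf_def)+
  moreover have "Bot \<notin> \<Gamma>" "Top \<notin> \<Gamma>" "\<phi> \<noteq> Top" using cf by (auto simp: Fm_cf_def)
  ultimately show "(\<Gamma>, \<phi>) \<in> L"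
    using red cf(2) by (simp add: subst_Var reduced_entails_def)
next
  fix \<Gamma> \<phi> assume rule: "(\<Gamma>, \<phi>) \<in> L"
  have "reduced_entails L (subst \<sigma> ` \<Gamma>) (subst \<sigma> \<phi>)" for \<sigma>
  proof (cases "Bot \<in> reduce ` subst \<sigma> ` \<Gamma>")
    case False
    define \<Delta> where "\<Delta> = reduce ` subst \<sigma> ` \<Gamma> - {Top}"
    have "(\<Delta>, \<psi>) \<in> L" if \<psi>: "\<psi> \<in> Fm_cf" "reduce (subst \<sigma> \<phi>) \<in> {Bot, \<psi>}" for \<psi>
    proof -
      have ins: "(insert \<gamma> \<Delta>, \<psi>) \<in> L" if "\<gamma> \<in> Fm_cf" for \<gamma>
        unfolding \<Delta>_def by (rule reduced_subst_derivable[OF L ext rule False \<psi> that])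
      show ?thesis
      proof (cases "\<Delta> = {}")
        case True
        thus ?thesis using theorems[OF \<psi>(1)] ins by simp
      next
        case False
        then obtain \<gamma> where "\<gamma> \<in> \<Delta>" by blast
        moreover have "\<Delta> \<subseteq> Fm_cf" unfolding \<Delta>_def by (rule reduce_image_cf) fact
        ultimately show ?thesis using ins[of \<gamma>] by (simp add: insert_absorb subset_iff)
      qed
    qed
    thus ?thesis unfolding reduced_entails_def \<Delta>_def by blast
  qed (auto simp: reduced_entails_def)
  thus "(\<Gamma>, \<phi>) \<in> cf_fragment (constant_expansion L)"
    using logic_closed[OF L rule] by (simp add: cf_fragment_def constant_expansion_def)
qed

section \<open>Theoremless extensions of the minus logic of LP\<close>

text \<open>Collapsing the variables of \<open>\<phi>\<close> to \<open>\<chi>\<close> gives a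
  formula with value \<open>DMn\<close> whenever \<open>\<chi>\<close> has it. Where that formula is
  designated, \<open>\<chi>\<close> is therefore not \<open>DMn\<close>, and excluded middle holds
  for it.\<close>

lemma excluded_middle_derivable:
  assumes L: "is_logic Fm_cf L" and ext: "cf_fragment BD \<subseteq> L"
    and \<phi>: "\<phi> \<in> Fm_cf" "\<And>\<gamma>. \<gamma> \<in> Fm_cf \<Longrightarrow> ({\<gamma>}, \<phi>) \<in> L"
    and cf: "\<gamma> \<in> Fm_cf" "\<chi> \<in> Fm_cf"
  shows "({\<gamma>}, Disj \<chi> (Neg \<chi>)) \<in> L"
proof -
  obtain n where n: "\<forall>v w. (\<forall>i<n. v i = w i) \<longrightarrow> eval v \<phi> = eval w \<phi>"
    using eval_finitely_determined[of \<phi>] by (elim exE)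
  define \<sigma> where "\<sigma> = (\<lambda>x. if x < n then \<chi> else \<gamma>)"
  have \<sigma>: "range \<sigma> \<subseteq> Fm_cf" using cf by (auto simp: \<sigma>_def)
  \<comment> \<open>The value of \<open>\<phi>\<close> does not depend on variable \<open>n\<close>,
    so this premise can become \<open>\<gamma>\<close> while the variables below \<open>n\<close>
    become \<open>\<chi>\<close>.\<close>
  have "({Var n}, \<phi>) \<in> L" by (rule \<phi>(2)) (simp add: Fm_cf_def)
  from logic_subst[OF L this \<sigma>] have step: "({\<gamma>}, subst \<sigma> \<phi>) \<in> L" by (simp add: \<sigma>_def)
  have "({subst \<sigma> \<phi>}, Disj \<chi> (Neg \<chi>)) \<in> BD"
    unfolding BD_iff
  proof (intro allI impI)
    fix v assume "\<forall>\<gamma>\<in>{subst \<sigma> \<phi>}. designated (eval v \<gamma>)"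
    moreover have "eval v (subst \<sigma> \<phi>) = eval (\<lambda>_. eval v \<chi>) \<phi>"
      unfolding eval_subst by (rule n[rule_format]) (simp add: \<sigma>_def)
    ultimately have "designated (eval (\<lambda>_. eval v \<chi>) \<phi>)" by simp
    hence "eval v \<chi> \<noteq> DMn"
      using eval_const[of \<phi> DMn "\<lambda>_. DMn"] \<phi>(1) by (auto simp: Fm_cf_def designated_def)
    thus "designated (eval v (Disj \<chi> (Neg \<chi>)))" by (cases "eval v \<chi>") (auto simp: dm4_defs)
  qed
  hence "({subst \<sigma> \<phi>}, Disj \<chi> (Neg \<chi>)) \<in> L"
    using cf \<phi>(1) subst_constant_free[OF _ \<sigma>]
    by (intro cf_BD_memberI[OF ext]) (auto simp: Fm_cf_def)
  thus ?thesis by (rule logic_cut[OF L, rotated 2]) (use cf step in auto)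
qed

text \<open>Gapless valuations are exactly those satisfying excluded middle for every variable. So
  an LP rule is a BD rule with these infinitely many extra premises, and any one premise of the rule
  derives them.\<close>

lemma minus_LP_subset:
  assumes L: "is_logic Fm_cf L" and ext: "cf_fragment BD \<subseteq> L"
    and em: "\<And>\<gamma> \<chi>. \<gamma> \<in> Fm_cf \<Longrightarrow> \<chi> \<in> Fm_cf \<Longrightarrow> ({\<gamma>}, Disj \<chi> (Neg \<chi>)) \<in> L"
  shows "minus_logic LP \<subseteq> L"
proof clarify
  fix \<Gamma> \<phi> assume "(\<Gamma>, \<phi>) \<in> minus_logic LP"
  hence \<Gamma>: "\<Gamma> \<subseteq> Fm_cf" "\<phi> \<in> Fm_cf" "\<Gamma> \<noteq> {}" "(\<Gamma>, \<phi>) \<in> LP" by (auto simp: minus_logic_iff)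
  then obtain \<gamma> where \<gamma>: "\<gamma> \<in> \<Gamma>" by blast
  define E where "E = range (\<lambda>x. Disj (Var x) (Neg (Var x)))"
  have E: "E \<subseteq> Fm_cf" by (auto simp: E_def Fm_cf_def)
  have "(\<Gamma> \<union> E, \<phi>) \<in> BD"
    unfolding BD_iff
  proof (intro allI impI)
    fix v assume v: "\<forall>\<gamma>\<in>\<Gamma> \<union> E. designated (eval v \<gamma>)"
    have "v x \<in> {DMbot, DMb, DMtop}" for x
    proof -
      have "designated (eval v (Disj (Var x) (Neg (Var x))))" using v unfolding E_def by blast
      thus ?thesis by (cases "v x") (auto simp: dm4_defs)
    qed
    hence "gapless v" by blast
    thus "designated (eval v \<phi>)" using \<Gamma>(4) v unfolding LP_iff by blast
  qed
  hence "(\<Gamma> \<union> E, \<phi>) \<in> L" using \<Gamma> E by (intro cf_BD_memberI[OF ext]) auto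
  thus "(\<Gamma>, \<phi>) \<in> L"
  proof (rule logic_cut[OF L \<Gamma>(1), rotated])
    fix \<delta> assume "\<delta> \<in> \<Gamma> \<union> E"
    thus "(\<Gamma>, \<delta>) \<in> L"
    proof
      assume "\<delta> \<in> \<Gamma>"
      thus ?thesis using logic_refl[OF L] \<Gamma>(1) by blast
    next
      assume "\<delta> \<in> E"
      then obtain x where x: "\<delta> = Disj (Var x) (Neg (Var x))" unfolding E_def by blast
      have "({\<gamma>}, \<delta>) \<in> L" unfolding x using \<gamma> \<Gamma>(1) by (intro em) (auto simp: Fm_cf_def)
      thus ?thesis by (rule logic_mono[OF L]) (use \<gamma> \<Gamma>(1) in auto)
    qed
  qed
qed

section \<open>Rules that force a step up the chain of logics\<close>

abbreviation explosion :: rule where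
  "explosion \<equiv> ({Var 0, Neg (Var 0)}, Var 1)"

abbreviation disjunctive_syllogism :: rule where
  "disjunctive_syllogism \<equiv> ({Var 0, Disj (Neg (Var 0)) (Var 1)}, Var 1)"

text \<open>Reduces the use of one rule of \<open>L\<close> to two checks in \<open>M\<close>:
  \<open>\<Delta>\<close> yields the instantiated premises, and together with the instantiated
  conclusion it yields \<open>\<psi>\<close>. Nonempty \<open>\<Delta>\<close> places these in
  \<open>minus_logic M\<close>.\<close>

lemma derivable_from_instance:
  assumes L: "is_logic Fm_cf L" and M: "minus_logic M \<subseteq> L" and rule: "(\<Gamma>, \<phi>) \<in> L"
    and \<sigma>: "range \<sigma> \<subseteq> Fm_cf" and \<Delta>: "\<Delta> \<subseteq> Fm_cf" "\<Delta> \<noteq> {}" and \<psi>: "\<psi> \<in> Fm_cf"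
    and prem: "\<And>\<gamma>. \<gamma> \<in> \<Gamma> \<Longrightarrow> (\<Delta>, subst \<sigma> \<gamma>) \<in> M"
    and concl: "(insert (subst \<sigma> \<phi>) \<Delta>, \<psi>) \<in> M"
  shows "(\<Delta>, \<psi>) \<in> L"
proof -
  have cf: "subst \<sigma> \<chi> \<in> Fm_cf" if "\<chi> \<in> insert \<phi> \<Gamma>" for \<chi>
    using that logic_closed[OF L rule] subst_constant_free[OF _ \<sigma>] by (auto simp: Fm_cf_def)
  have inst: "(\<Delta>, subst \<sigma> \<phi>) \<in> L"
  proof (rule logic_cut[OF L \<Delta>(1) _ logic_subst[OF L rule \<sigma>]])
    fix \<delta> assume "\<delta> \<in> subst \<sigma> ` \<Gamma>"
    hence "(\<Delta>, \<delta>) \<in> minus_logic M" using prem cf \<Delta> by (auto simp: minus_logic_iff)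
    thus "(\<Delta>, \<delta>) \<in> L" using M by blast
  qed
  have "(insert (subst \<sigma> \<phi>) \<Delta>, \<psi>) \<in> minus_logic M"
    using concl cf \<Delta> \<psi> by (auto simp: minus_logic_iff)
  hence "(insert (subst \<sigma> \<phi>) \<Delta>, \<psi>) \<in> L" using M by blast
  thus ?thesis
    by (rule logic_cut[OF L \<Delta>(1), rotated]) (use inst logic_refl[OF L _ \<Delta>(1)] in blast)
qed

text \<open>Given \<open>p\<close> and \<open>\<sim>p\<close>, the formula \<open>q \<and> p \<and> \<sim>p\<close> takes only the values \<open>\<bottom>\<close> and \<open>b\<close>, so
  it can replace \<open>\<bottom>\<close> when the refuting valuation is turned into a substitution.\<close>

lemma explosion_of_non_LP_rule:
  assumes L: "is_logic Fm_cf L" and LP: "minus_logic LP \<subseteq> L"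
    and rule: "(\<Gamma>, \<phi>) \<in> L" "(\<Gamma>, \<phi>) \<notin> LP"
  shows "explosion \<in> L"
proof -
  obtain v where v: "gapless v" "\<And>\<gamma>. \<gamma> \<in> \<Gamma> \<Longrightarrow> designated (eval v \<gamma>)" "\<not> designated (eval v \<phi>)"
    using rule(2) unfolding LP_iff by blast
  define K where "K = Conj (Var 1) (Conj (Var 0) (Neg (Var 0)))"
  define \<sigma> where "\<sigma> = (\<lambda>x. if v x = DMb then Var 0 else if v x = DMbot then K else Neg K)"
  have vx: "v x \<in> {DMbot, DMb, DMtop}" for x using v(1) by blast
  have w0: "w 0 = DMb" if "\<forall>\<gamma>\<in>{Var 0, Neg (Var 0)}. designated (eval w \<gamma>)" for w
    using that by (cases "w 0") (auto simp: designated_def)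
  \<comment> \<open>Whatever the value of \<open>Var 1\<close>, the substitution stays
    information-above \<open>v\<close>, which keeps the premises designated. At \<open>DMbot\<close>
    it reproduces \<open>v\<close>, so there the conclusion fails.\<close>
  have above: "less_info (v x) (eval w (\<sigma> x))" if "gapless w" "w 0 = DMb" for w x
  proof -
    have "w 1 \<in> {DMbot, DMb, DMtop}" using that(1) by blast
    thus ?thesis using that(2) vx[of x] by (auto simp: \<sigma>_def K_def less_info_def dm4_defs)
  qed
  have exact: "(\<lambda>x. eval w (\<sigma> x)) = v" if "w 1 = DMbot" "w 0 = DMb" for w
  proof
    fix x
    show "eval w (\<sigma> x) = v x" using that vx[of x] by (auto simp: \<sigma>_def K_def dm4_defs)
  qed
  show ?thesis
  proof (rule derivable_from_instance[OF L LP rule(1), of \<sigma>])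
    show "range \<sigma> \<subseteq> Fm_cf" by (auto simp: \<sigma>_def K_def Fm_cf_def)
    show "({Var 0, Neg (Var 0)}, subst \<sigma> \<gamma>) \<in> LP" if "\<gamma> \<in> \<Gamma>" for \<gamma>
      unfolding LP_iff eval_subst
    proof (intro allI impI)
      fix w assume "gapless w" "\<forall>\<gamma>\<in>{Var 0, Neg (Var 0)}. designated (eval w \<gamma>)"
      thus "designated (eval (\<lambda>x. eval w (\<sigma> x)) \<gamma>)"
        using designated_eval_mono[OF above v(2)[OF that]] w0 by simp
    qed
    show "(insert (subst \<sigma> \<phi>) {Var 0, Neg (Var 0)}, Var 1) \<in> LP"
      unfolding LP_iff
    proof (intro allI impI)
      fix w assume w: "gapless w"
        "\<forall>\<gamma>\<in>insert (subst \<sigma> \<phi>) {Var 0, Neg (Var 0)}. designated (eval w \<gamma>)"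
      have "w 1 \<noteq> DMbot"
      proof
        assume "w 1 = DMbot"
        hence "eval w (subst \<sigma> \<phi>) = eval v \<phi>" unfolding eval_subst using exact w0 w(2) by simp
        thus False using v(3) w(2) by simp
      qed
      moreover have "w 1 \<in> {DMbot, DMb, DMtop}" using w(1) by blast
      ultimately show "designated (eval w (Var 1))" by (auto simp: designated_def)
    qed
  qed (auto simp: Fm_cf_def)
qed

text \<open>The substitution pairs a gapless refutation \<open>v\<close> of the rule with a classical model \<open>w\<close> of
  its premises: it yields \<open>v\<close> at \<open>p = b, q = \<bottom>\<close>, the only gapless refutation of disjunctive
  syllogism, and \<open>w\<close> at \<open>p = q = \<top>\<close>, the only classical model of its premises.\<close>

lemma disjunctive_syllogism_of_satisfiable_non_LP_rule:
  assumes L: "is_logic Fm_cf L" and LP: "minus_logic LP \<subseteq> L"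
    and rule: "(\<Gamma>, \<phi>) \<in> L" "(\<Gamma>, \<phi>) \<notin> LP"
    and w: "classical w" "\<And>\<gamma>. \<gamma> \<in> \<Gamma> \<Longrightarrow> designated (eval w \<gamma>)"
  shows "disjunctive_syllogism \<in> L"
proof -
  obtain v where v: "gapless v" "\<And>\<gamma>. \<gamma> \<in> \<Gamma> \<Longrightarrow> designated (eval v \<gamma>)" "\<not> designated (eval v \<phi>)"
    using rule(2) unfolding LP_iff by blast
  define p q where "p = Var 0" and "q = Var 1"
  define \<sigma> where "\<sigma> = (\<lambda>x.
    if v x = DMb then if w x = DMtop then p else Neg p
    else if v x = DMtop then if w x = DMtop then Disj q (Neg q) else Neg q
    else if w x = DMtop then q else Conj q (Neg q))"
  have vx: "v x \<in> {DMbot, DMb, DMtop}" for x using v(1) by blast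
  have wx: "w x \<in> {DMbot, DMtop}" for x using w(1) by blast
  let ?P = "{Var 0, Disj (Neg (Var 0)) (Var 1)}"
  have models: "u 0 = DMb \<and> u 1 = DMbot \<or> u 0 \<in> {DMb, DMtop} \<and> u 1 \<in> {DMb, DMtop}"
    if "gapless u" "\<forall>\<gamma>\<in>?P. designated (eval u \<gamma>)" for u
  proof -
    have "u 0 \<in> {DMbot, DMb, DMtop}" "u 1 \<in> {DMbot, DMb, DMtop}" using that(1) by blast+
    thus ?thesis using that(2) by (auto simp: dm4_defs)
  qed
  have exact: "(\<lambda>x. eval u (\<sigma> x)) = v" if "u 0 = DMb" "u 1 = DMbot" for u
  proof
    fix x
    show "eval u (\<sigma> x) = v x" using that vx[of x] by (auto simp: \<sigma>_def p_def q_def dm4_defs)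
  qed
  \<comment> \<open>In the remaining models of the premises both variables are designated, and the
    substitution stays information-above \<open>w\<close>.\<close>
  have above: "less_info (w x) (eval u (\<sigma> x))"
    if "u 0 \<in> {DMb, DMtop}" "u 1 \<in> {DMb, DMtop}" for u x
    using that vx[of x] wx[of x] by (auto simp: \<sigma>_def p_def q_def less_info_def dm4_defs)
  show ?thesis
  proof (rule derivable_from_instance[OF L LP rule(1), of \<sigma>])
    show "range \<sigma> \<subseteq> Fm_cf" by (auto simp: \<sigma>_def p_def q_def Fm_cf_def)
    show "(?P, subst \<sigma> \<gamma>) \<in> LP" if "\<gamma> \<in> \<Gamma>" for \<gamma>
      unfolding LP_iff eval_subst
    proof (intro allI impI)
      fix u assume "gapless u" "\<forall>\<gamma>\<in>?P. designated (eval u \<gamma>)"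
      from models[OF this] show "designated (eval (\<lambda>x. eval u (\<sigma> x)) \<gamma>)"
      proof
        assume "u 0 = DMb \<and> u 1 = DMbot"
        thus ?thesis using exact[of u] v(2)[OF that] by simp
      next
        assume "u 0 \<in> {DMb, DMtop} \<and> u 1 \<in> {DMb, DMtop}"
        thus ?thesis 
          using designated_eval_mono[of w "\<lambda>x. eval u (\<sigma> x)", OF above w(2)[OF that]] by blast
      qed
    qed
    show "(insert (subst \<sigma> \<phi>) ?P, Var 1) \<in> LP"
      unfolding LP_iff
    proof (intro allI impI)
      fix u assume u: "gapless u" "\<forall>\<gamma>\<in>insert (subst \<sigma> \<phi>) ?P. designated (eval u \<gamma>)"
      have "\<not> (u 0 = DMb \<and> u 1 = DMbot)"
      proof
        assume "u 0 = DMb \<and> u 1 = DMbot"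
        hence "eval u (subst \<sigma> \<phi>) = eval v \<phi>" unfolding eval_subst using exact by simp
        thus False using v(3) u(2) by simp
      qed
      moreover have "\<forall>\<gamma>\<in>?P. designated (eval u \<gamma>)" using u(2) by blast
      ultimately show "designated (eval u (Var 1))"
        using models[OF u(1)] by (auto simp: designated_def)
    qed
  qed (auto simp: Fm_cf_def)
qed

text \<open>Excluded middle is put for the variables true under a refuting \<open>v\<close>, a
  contradiction for the false ones. The instantiated premises become classical tautologies and the
  conclusion a contradiction.\<close>

lemma almost_trivial_of_non_CL_rule:
  assumes L: "is_logic Fm_cf L" and CL: "minus_logic CL \<subseteq> L"
    and rule: "(\<Gamma>, \<phi>) \<in> L" "(\<Gamma>, \<phi>) \<notin> CL"
  shows "almost_trivial \<subseteq> L"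
proof clarify
  fix \<Delta> \<psi> assume "(\<Delta>, \<psi>) \<in> almost_trivial"
  hence \<Delta>: "\<Delta> \<subseteq> Fm_cf" "\<Delta> \<noteq> {}" "\<psi> \<in> Fm_cf" by (auto simp: almost_trivial_def)
  obtain v where v: "classical v" "\<And>\<gamma>. \<gamma> \<in> \<Gamma> \<Longrightarrow> designated (eval v \<gamma>)" "\<not> designated (eval v \<phi>)"
    using rule(2) unfolding CL_iff by blast
  define \<sigma> where "\<sigma> = (\<lambda>x.
    if v x = DMtop then Disj (Var 0) (Neg (Var 0)) else Conj (Var 0) (Neg (Var 0)))"
  have exact: "eval w (subst \<sigma> \<chi>) = eval v \<chi>" if "classical w" for w \<chi>
  proof -
    have "eval w (\<sigma> x) = v x" for x
    proof -
      have "v x \<in> {DMbot, DMtop}" "w 0 \<in> {DMbot, DMtop}" using v(1) that by blast+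
      thus ?thesis by (auto simp: \<sigma>_def dm4_defs)
    qed
    thus ?thesis unfolding eval_subst by simp
  qed
  show "(\<Delta>, \<psi>) \<in> L"
  proof (rule derivable_from_instance[OF L CL rule(1) _ \<Delta>, of \<sigma>])
    show "range \<sigma> \<subseteq> Fm_cf" by (auto simp: \<sigma>_def Fm_cf_def)
    show "(\<Delta>, subst \<sigma> \<gamma>) \<in> CL" if "\<gamma> \<in> \<Gamma>" for \<gamma>
      unfolding CL_iff using exact v(2)[OF that] by simp
    show "(insert (subst \<sigma> \<phi>) \<Delta>, \<psi>) \<in> CL"
      unfolding CL_iff using exact v(3) by simp
  qed
qed

text \<open>A formula \<open>\<gamma>\<close> obtained from the premises by compactness entails
  \<open>\<phi>\<close> classically, so \<open>Disj (Neg \<gamma>) \<phi>\<close> is a classical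
  tautology and holds in LP; disjunctive syllogism detaches \<open>\<phi>\<close>.\<close>

lemma CL_derivable_by_disjunctive_syllogism:
  assumes L: "is_logic Fm_cf L" and LP: "minus_logic LP \<subseteq> L" and ds: "disjunctive_syllogism \<in> L"
  shows "minus_logic CL \<subseteq> L"
proof clarify
  fix \<Gamma> \<phi> assume "(\<Gamma>, \<phi>) \<in> minus_logic CL"
  hence \<Gamma>: "\<Gamma> \<subseteq> Fm_cf" "\<phi> \<in> Fm_cf" "\<Gamma> \<noteq> {}" "(\<Gamma>, \<phi>) \<in> CL" by (auto simp: minus_logic_iff)
  obtain \<gamma> where \<gamma>: "\<gamma> \<in> Fm_cf" "(\<Gamma>, \<gamma>) \<in> BD" "({\<gamma>}, \<phi>) \<in> CL"
    using CL_finite_premise[OF \<Gamma>(4,1,3)] by blast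
  have "designated (eval v (Disj (Neg \<gamma>) \<phi>))" if "gapless v" for v
    using that
  proof (rule gapless_of_classical_tautology[rotated])
    fix w assume w: "classical w"
    hence "designated (eval w \<gamma>) \<longrightarrow> designated (eval w \<phi>)" using \<gamma>(3) unfolding CL_iff by blast
    thus "designated (eval w (Disj (Neg \<gamma>) \<phi>))"
      using eval_classical[OF w, of \<gamma>] unfolding eval.simps designated_sup
      by (auto simp: designated_def)
  qed
  hence "(\<Gamma>, Disj (Neg \<gamma>) \<phi>) \<in> minus_logic LP"
    using \<Gamma> \<gamma>(1) unfolding minus_logic_iff LP_iff by (simp add: Fm_cf_def)
  moreover have "(\<Gamma>, \<gamma>) \<in> minus_logic LP"
    using \<Gamma> \<gamma> BD_subset_LP unfolding minus_logic_iff by blast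
  ultimately have prem: "(\<Gamma>, \<gamma>) \<in> L" "(\<Gamma>, Disj (Neg \<gamma>) \<phi>) \<in> L" using LP by blast+
  have "range (\<lambda>x. if x = 0 then \<gamma> else \<phi>) \<subseteq> Fm_cf" using \<gamma>(1) \<Gamma>(2) by auto
  from logic_subst[OF L ds this] have "({\<gamma>, Disj (Neg \<gamma>) \<phi>}, \<phi>) \<in> L" by simp
  thus "(\<Gamma>, \<phi>) \<in> L" by (rule logic_cut[OF L \<Gamma>(1), rotated]) (use prem in auto)
qed

text \<open>By compactness the premises yield one contradictory formula \<open>\<gamma>\<close>. Its
  negation is a classical tautology, hence holds in LP, and explosion applies to the pair.\<close>

lemma unsatisfiable_derivable_by_explosion:
  assumes L: "is_logic Fm_cf L" and LP: "minus_logic LP \<subseteq> L" and ex: "explosion \<in> L"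
    and \<Gamma>: "\<Gamma> \<subseteq> Fm_cf" "\<phi> \<in> Fm_cf"
    and unsat: "\<And>v. classical v \<Longrightarrow> \<exists>\<gamma>\<in>\<Gamma>. \<not> designated (eval v \<gamma>)"
  shows "(\<Gamma>, \<phi>) \<in> L"
proof -
  have ne: "\<Gamma> \<noteq> {}" using unsat[of "\<lambda>_. DMtop"] by auto
  have "(\<Gamma>, Bot) \<in> CL" unfolding CL_iff using unsat by blast
  then obtain \<gamma> where \<gamma>: "\<gamma> \<in> Fm_cf" "(\<Gamma>, \<gamma>) \<in> BD" "({\<gamma>}, Bot) \<in> CL"
    using CL_finite_premise \<Gamma>(1) ne by blast
  have "designated (eval v (Neg \<gamma>))" if "gapless v" for v
    using that
  proof (rule gapless_of_classical_tautology[rotated])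
    fix w assume w: "classical w"
    hence "\<not> designated (eval w \<gamma>)" using \<gamma>(3) unfolding CL_iff by (auto simp: dm4_defs)
    thus "designated (eval w (Neg \<gamma>))"
      using eval_classical[OF w, of \<gamma>] by (auto simp: designated_def)
  qed
  hence "(\<Gamma>, Neg \<gamma>) \<in> minus_logic LP"
    using \<Gamma> ne \<gamma>(1) unfolding minus_logic_iff LP_iff by (simp add: Fm_cf_def)
  moreover have "(\<Gamma>, \<gamma>) \<in> minus_logic LP"
    using \<Gamma> ne \<gamma> BD_subset_LP unfolding minus_logic_iff by blast
  ultimately have prem: "(\<Gamma>, \<gamma>) \<in> L" "(\<Gamma>, Neg \<gamma>) \<in> L" using LP by blast+
  have "range (\<lambda>x. if x = 0 then \<gamma> else \<phi>) \<subseteq> Fm_cf" using \<gamma>(1) \<Gamma>(2) by auto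
  from logic_subst[OF L ex this] have "({\<gamma>, Neg \<gamma>}, \<phi>) \<in> L" by simp
  thus ?thesis by (rule logic_cut[OF L \<Gamma>(1), rotated]) (use prem in auto)
qed

section \<open>The join of LP and ECQ\<close>

lemma LP_subset_join: "LP \<subseteq> logic_join Fm LP ECQ"
  using least_logic_upper unfolding logic_join_def by blast

lemma explosion_in_join: "explosion \<in> logic_join Fm LP ECQ"
proof -
  have "explosion \<in> ECQ" unfolding ECQ_def using least_logic_upper by blast
  thus ?thesis unfolding logic_join_def using least_logic_upper by blast
qed

text \<open>The rules that are LP-valid or have classically unsatisfiable premises form a logic
  \<open>J\<close> that contains LP and explosion, hence the join.\<close>

lemma join_LP_ECQ_sound:
  assumes "(\<Gamma>, \<phi>) \<in> logic_join Fm LP ECQ" "(\<Gamma>, \<phi>) \<notin> LP" "classical v"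
  shows "\<exists>\<gamma>\<in>\<Gamma>. \<not> designated (eval v \<gamma>)"
proof -
  define sat where "sat = (\<lambda>\<Gamma>. \<exists>v. classical v \<and> (\<forall>\<gamma>\<in>\<Gamma>. designated (eval v \<gamma>)))"
  define J where "J = {(\<Gamma>, \<phi>). sat \<Gamma> \<longrightarrow> (\<Gamma>, \<phi>) \<in> LP}"
  have J_iff: "(\<Gamma>, \<phi>) \<in> J \<longleftrightarrow> (sat \<Gamma> \<longrightarrow> (\<Gamma>, \<phi>) \<in> LP)" for \<Gamma> \<phi> by (simp add: J_def)
  have J: "is_logic Fm J"
  proof (rule is_logicI)
    show "\<Gamma> \<subseteq> Fm \<and> \<phi> \<in> Fm" for \<Gamma> \<phi> by (simp add: Fm_def)
    show "({\<phi>}, \<phi>) \<in> J" for \<phi> by (simp add: J_iff LP_iff)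
    show "(\<Gamma> \<union> \<Delta>, \<phi>) \<in> J" if "(\<Gamma>, \<phi>) \<in> J" for \<Gamma> \<Delta> \<phi>
      using that unfolding J_iff sat_def LP_iff by blast
    show "(\<Gamma>, \<phi>) \<in> J"
      if \<Delta>: "\<forall>\<delta>\<in>\<Delta>. (\<Gamma>, \<delta>) \<in> J" and \<phi>: "(\<Gamma> \<union> \<Delta>, \<phi>) \<in> J" for \<Gamma> \<Delta> \<phi>
      unfolding J_iff
    proof
      assume sat: "sat \<Gamma>"
      then obtain w where w: "classical w" "\<forall>\<gamma>\<in>\<Gamma>. designated (eval w \<gamma>)"
        unfolding sat_def by blast
      \<comment> \<open>Cut needs a classical model of \<open>\<Gamma>\<close> to be one of
        \<open>\<Delta>\<close> as well; this holds since LP is contained in CL.\<close>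
      have LP: "\<forall>\<delta>\<in>\<Delta>. (\<Gamma>, \<delta>) \<in> LP" using \<Delta> sat unfolding J_iff by blast
      hence "\<forall>\<delta>\<in>\<Delta>. (\<Gamma>, \<delta>) \<in> CL" using LP_subset_CL by blast
      hence "\<forall>\<delta>\<in>\<Delta>. designated (eval w \<delta>)" using w unfolding CL_iff by blast
      hence "sat (\<Gamma> \<union> \<Delta>)" unfolding sat_def using w by blast
      hence "(\<Gamma> \<union> \<Delta>, \<phi>) \<in> LP" using \<phi> unfolding J_iff by blast
      thus "(\<Gamma>, \<phi>) \<in> LP" using logic_cut_union[OF is_logic_LP LP] by blast
    qed
    show "(subst \<sigma> ` \<Gamma>, subst \<sigma> \<phi>) \<in> J" if "(\<Gamma>, \<phi>) \<in> J" for \<sigma> \<Gamma> \<phi>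
      unfolding J_iff
    proof
      assume "sat (subst \<sigma> ` \<Gamma>)"
      then obtain w where w: "classical w" "\<forall>\<gamma>\<in>\<Gamma>. designated (eval (\<lambda>x. eval w (\<sigma> x)) \<gamma>)"
        unfolding sat_def by (auto simp: eval_subst)
      have "classical (\<lambda>x. eval w (\<sigma> x))" using eval_classical[OF w(1)] by blast
      hence "sat \<Gamma>" unfolding sat_def using w(2) by blast
      thus "(subst \<sigma> ` \<Gamma>, subst \<sigma> \<phi>) \<in> LP"
        using that logic_subst[OF is_logic_LP] unfolding J_iff by (simp add: Fm_def)
    qed
  qed
  have LP: "LP \<subseteq> J" unfolding J_def by blast
  have "explosion \<in> J"
  proof -
    have "\<not> sat {Var 0, Neg (Var 0)}"
    proof
      assume "sat {Var 0, Neg (Var 0)}"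
      then obtain w where w: "classical w" "designated (w 0)" "designated (dm_neg (w 0))"
        unfolding sat_def by auto
      have "w 0 \<in> {DMbot, DMtop}" using w(1) by blast
      thus False using w(2,3) by (auto simp: designated_def)
    qed
    thus ?thesis unfolding J_iff by blast
  qed
  hence "ECQ \<subseteq> J"
    unfolding ECQ_def using BD_subset_LP LP by (intro least_logic_least[OF J]) blast
  hence "logic_join Fm LP ECQ \<subseteq> J"
    unfolding logic_join_def using LP by (intro least_logic_least[OF J]) blast
  thus ?thesis using assms unfolding J_def sat_def by blast
qed

lemma minus_logic_mono: "L \<subseteq> L' \<Longrightarrow> minus_logic L \<subseteq> minus_logic L'"
  unfolding minus_logic_def cf_fragment_def by blast

text \<open>Climbs the chain: if \<open>L\<close> contains one of the logics and differs from it,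
  then \<open>L\<close> has a rule outside it, and that rule forces \<open>L\<close> to contain the
  next.\<close>

lemma theoremless_extensions_of_LP:
  assumes L: "is_logic Fm_cf L" and LP: "minus_logic LP \<subseteq> L" and AT: "L \<subseteq> almost_trivial"
  shows "L \<in> {minus_logic LP, minus_logic (logic_join Fm LP ECQ), minus_logic CL, almost_trivial}"
proof -
  let ?J = "logic_join Fm LP ECQ"
  \<comment> \<open>All rules of \<open>L\<close> lie in \<open>almost_trivial\<close>, so one
    outside \<open>minus_logic M\<close> is outside \<open>M\<close> itself.\<close>
  have outside: "\<exists>\<Gamma> \<phi>. (\<Gamma>, \<phi>) \<in> L \<and> (\<Gamma>, \<phi>) \<notin> M \<and> (\<Gamma>, \<phi>) \<notin> minus_logic M \<and> \<Gamma> \<subseteq> Fm_cf \<and> \<phi> \<in> Fm_cf"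
    if "minus_logic M \<subseteq> L" "L \<noteq> minus_logic M" for M
  proof -
    have "\<not> L \<subseteq> minus_logic M" using that by blast
    then obtain \<Gamma> \<phi> where r: "(\<Gamma>, \<phi>) \<in> L" "(\<Gamma>, \<phi>) \<notin> minus_logic M"
      unfolding subset_iff split_paired_All by blast
    moreover have "(\<Gamma>, \<phi>) \<in> almost_trivial" using r AT by blast
    ultimately show ?thesis unfolding minus_logic_iff almost_trivial_def by blast
  qed
  show ?thesis
  proof (cases "L = minus_logic LP")
    case False
    then obtain \<Gamma> \<phi> where "(\<Gamma>, \<phi>) \<in> L" "(\<Gamma>, \<phi>) \<notin> LP" using outside[OF LP] by blast
    hence ex: "explosion \<in> L" by (rule explosion_of_non_LP_rule[OF L LP])
    have J: "minus_logic ?J \<subseteq> L"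
    proof clarify
      fix \<Gamma> \<phi> assume r: "(\<Gamma>, \<phi>) \<in> minus_logic ?J"
      show "(\<Gamma>, \<phi>) \<in> L"
      proof (cases "(\<Gamma>, \<phi>) \<in> LP")
        case True
        hence "(\<Gamma>, \<phi>) \<in> minus_logic LP" using r unfolding minus_logic_iff by blast
        thus ?thesis using LP by blast
      next
        case False
        thus ?thesis
          using r join_LP_ECQ_sound unfolding minus_logic_iff
          by (intro unsatisfiable_derivable_by_explosion[OF L LP ex]) blast+
      qed
    qed
    show ?thesis
    proof (cases "L = minus_logic ?J")
      case False
      then obtain \<Gamma> \<phi> where r: "(\<Gamma>, \<phi>) \<in> L" "(\<Gamma>, \<phi>) \<notin> ?J" "(\<Gamma>, \<phi>) \<notin> minus_logic ?J"
        "\<Gamma> \<subseteq> Fm_cf" "\<phi> \<in> Fm_cf" using outside[OF J] by blast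
      \<comment> \<open>In the join, explosion already derives every conclusion from unsatisfiable
        premises, so the premises of a rule outside it have a classical model.\<close>
      have "explosion \<in> minus_logic ?J"
        using explosion_in_join unfolding minus_logic_iff by (simp add: Fm_cf_def)
      from unsatisfiable_derivable_by_explosion[OF is_logic_minus_logic[OF is_logic_logic_join]
          minus_logic_mono[OF LP_subset_join] this r(4,5)]
      obtain w where w: "classical w" "\<And>\<gamma>. \<gamma> \<in> \<Gamma> \<Longrightarrow> designated (eval w \<gamma>)"
        using r(3) by blast
      have "(\<Gamma>, \<phi>) \<notin> LP" using r(2) LP_subset_join by blast
      from disjunctive_syllogism_of_satisfiable_non_LP_rule[OF L LP r(1) this w]
      have CL: "minus_logic CL \<subseteq> L" by (rule CL_derivable_by_disjunctive_syllogism[OF L LP])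
      show ?thesis
      proof (cases "L = minus_logic CL")
        case False
        then obtain \<Gamma> \<phi> where "(\<Gamma>, \<phi>) \<in> L" "(\<Gamma>, \<phi>) \<notin> CL" using outside[OF CL] by blast
        hence "almost_trivial \<subseteq> L" by (rule almost_trivial_of_non_CL_rule[OF L CL])
        thus ?thesis using AT by blast
      qed simp
    qed simp
  qed simp
qed

section \<open>Fragments and non-fragments\<close>

lemma not_cf_fragment:
  assumes AT: "L \<subseteq> almost_trivial" and em: "({Var 1}, Disj (Var 0) (Neg (Var 0))) \<in> L"
    and L': "is_extension Fm BD L'"
  shows "L \<noteq> cf_fragment L'"
proof
  assume L: "L = cf_fragment L'"
  have log: "is_logic Fm L'" and BD: "BD \<subseteq> L'" using L' by (auto simp: is_extension_def)
  have "({Var 1}, Disj (Var 0) (Neg (Var 0))) \<in> L'" using em L by (auto simp: cf_fragment_def)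
  \<comment> \<open>\<open>Top\<close> replaces the premise and, being a theorem, can be cut. What
    remains is a constant-free theorem, which \<open>almost_trivial\<close> excludes.\<close>
  from logic_subst[OF log this, of "\<lambda>x. if x = 1 then Top else Var x"]
  have top: "({Top}, Disj (Var 0) (Neg (Var 0))) \<in> L'" by (simp add: Fm_def)
  have "({}, Top) \<in> L'" using BD by (auto simp: BD_iff dm4_defs)
  hence "({}, Disj (Var 0) (Neg (Var 0))) \<in> L'"
    by (intro logic_cut[OF log _ _ top]) (auto simp: Fm_def)
  hence "({}, Disj (Var 0) (Neg (Var 0))) \<in> L" by (simp add: L cf_fragment_def Fm_cf_def)
  thus False using AT by (auto simp: almost_trivial_def)
qed

lemma nonfragment_extension_bounds:
  assumes ext: "is_extension Fm_cf (cf_fragment BD) L"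
    and nonfrag: "\<not> (\<exists>L'. is_extension Fm BD L' \<and> L = cf_fragment L')"
  shows "minus_logic LP \<subseteq> L \<and> L \<subseteq> almost_trivial"
proof -
  have L: "is_logic Fm_cf L" and BD: "cf_fragment BD \<subseteq> L" using ext by (auto simp: is_extension_def)
  have "is_extension Fm BD (constant_expansion L)"
    using is_logic_constant_expansion[OF L] BD_subset_constant_expansion[OF BD]
    by (simp add: is_extension_def)
  hence "cf_fragment (constant_expansion L) \<noteq> L" using nonfrag by metis
  then obtain \<phi> where \<phi>: "\<phi> \<in> Fm_cf" "\<And>\<gamma>. \<gamma> \<in> Fm_cf \<Longrightarrow> ({\<gamma>}, \<phi>) \<in> L" "({}, \<phi>) \<notin> L"
    using cf_fragment_constant_expansion[OF L BD] by blast
  \<comment> \<open>Since \<open>\<phi>\<close> follows from any constant-free formula, a theorem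
    \<open>\<theta>\<close> would make \<open>\<phi>\<close> a theorem too.\<close>
  have "({}, \<theta>) \<notin> L" for \<theta>
  proof
    assume \<theta>: "({}, \<theta>) \<in> L"
    hence "({\<theta>}, \<phi>) \<in> L" using \<phi>(2) logic_closed[OF L] by blast
    hence "({}, \<phi>) \<in> L" by (rule logic_cut[OF L, rotated 2]) (use \<theta> in auto)
    thus False using \<phi>(3) by blast
  qed
  hence "L \<subseteq> almost_trivial" using logic_closed[OF L] by (fastforce simp: almost_trivial_def)
  moreover have "minus_logic LP \<subseteq> L"
    by (rule minus_LP_subset[OF L BD]) (rule excluded_middle_derivable[OF L BD \<phi>(1,2)])
  ultimately show ?thesis by blast
qed

lemma minus_logic_nonfragment:
  assumes "is_logic Fm M" "LP \<subseteq> M"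
  shows "is_extension Fm_cf (cf_fragment BD) (minus_logic M) \<and>
    \<not> (\<exists>L'. is_extension Fm BD L' \<and> minus_logic M = cf_fragment L')"
proof -
  have "({Var 1}, Disj (Var 0) (Neg (Var 0))) \<in> LP"
    unfolding LP_iff
  proof (intro allI impI)
    fix v assume "gapless v"
    hence "v 0 \<in> {DMbot, DMb, DMtop}" by blast
    thus "designated (eval v (Disj (Var 0) (Neg (Var 0))))" by (auto simp: dm4_defs)
  qed
  hence "({Var 1}, Disj (Var 0) (Neg (Var 0))) \<in> minus_logic M"
    using assms(2) by (auto simp: minus_logic_iff Fm_cf_def)
  moreover have "minus_logic M \<subseteq> almost_trivial" by (simp add: minus_logic_def)
  ultimately have "\<not> (\<exists>L'. is_extension Fm BD L' \<and> minus_logic M = cf_fragment L')"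
    using not_cf_fragment by blast
  moreover have "is_extension Fm_cf (cf_fragment BD) (minus_logic M)"
    using is_logic_minus_logic[OF assms(1)] cf_BD_subset_minus_logic BD_subset_LP assms(2)
    unfolding is_extension_def by blast
  ultimately show ?thesis by blast
qed

text \<open>Brings the almost trivial logic under the same construction, with the inconsistent logic
  as base, so that \<open>minus_logic_nonfragment\<close> covers all four.\<close>

lemma almost_trivial_eq_minus_logic: "almost_trivial = minus_logic UNIV"
  by (auto simp: minus_logic_def cf_fragment_def almost_trivial_def)

text \<open>Explosion, disjunctive syllogism and the inference from \<open>Var 0\<close> to
  \<open>Var 1\<close> separate consecutive members of the chain.\<close>

lemma four_logics_distinct:
  "card {minus_logic LP, minus_logic (logic_join Fm LP ECQ), minus_logic CL, almost_trivial} = 4"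
proof -
  let ?J = "logic_join Fm LP ECQ"
  have cf: "{Var 0, Neg (Var 0)} \<subseteq> Fm_cf" "{Var 0, Disj (Neg (Var 0)) (Var 1)} \<subseteq> Fm_cf"
    "{Var 0} \<subseteq> Fm_cf" "Var 1 \<in> Fm_cf" by (auto simp: Fm_cf_def)
  \<comment> \<open>This gapless valuation refutes both explosion and disjunctive syllogism.\<close>
  define u where "u = (\<lambda>x::nat. if x = 0 then DMb else DMbot)"
  have "explosion \<notin> LP" unfolding LP_iff by (auto simp: u_def dm4_defs intro!: exI[of _ u] split: if_splits)
  hence e: "explosion \<notin> minus_logic LP" by (simp add: minus_logic_iff)
  have exCL: "explosion \<in> CL"
    unfolding CL_iff
  proof (intro allI impI)
    fix v assume v: "classical v" "\<forall>\<gamma>\<in>{Var 0, Neg (Var 0)}. designated (eval v \<gamma>)"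
    have "v 0 \<in> {DMbot, DMtop}" using v(1) by blast
    thus "designated (eval v (Var 1))" using v(2) by (auto simp: designated_def)
  qed
  have e': "explosion \<in> minus_logic ?J" "explosion \<in> minus_logic CL" "explosion \<in> almost_trivial"
    using cf explosion_in_join exCL by (auto simp: minus_logic_iff almost_trivial_def)
  have dsLP: "disjunctive_syllogism \<notin> LP"
    unfolding LP_iff by (auto simp: u_def dm4_defs intro!: exI[of _ u] split: if_splits)
  \<comment> \<open>The premises of disjunctive syllogism have a classical model, so in the join the
    rule would have to be LP-valid.\<close>
  have "classical (\<lambda>_. DMtop)"
    "\<not> (\<exists>\<gamma>\<in>{Var 0, Disj (Neg (Var 0)) (Var 1)}. \<not> designated (eval (\<lambda>_. DMtop) \<gamma>))"
    by (auto simp: dm4_defs)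
  hence "disjunctive_syllogism \<notin> ?J" using join_LP_ECQ_sound[OF _ dsLP] by blast
  hence d: "disjunctive_syllogism \<notin> minus_logic ?J" by (simp add: minus_logic_iff)
  have "disjunctive_syllogism \<in> CL"
    unfolding CL_iff
  proof (intro allI impI)
    fix v assume v: "classical v" "\<forall>\<gamma>\<in>{Var 0, Disj (Neg (Var 0)) (Var 1)}. designated (eval v \<gamma>)"
    have "v 0 \<in> {DMbot, DMtop}" "v 1 \<in> {DMbot, DMtop}" using v(1) by blast+
    thus "designated (eval v (Var 1))" using v(2) by (auto simp: dm4_defs)
  qed
  hence d': "disjunctive_syllogism \<in> minus_logic CL" "disjunctive_syllogism \<in> almost_trivial"
    using cf by (auto simp: minus_logic_iff almost_trivial_def)
  have "({Var 0}, Var 1) \<notin> CL"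
    unfolding CL_iff
    by (auto simp: designated_def split: if_splits
        intro!: exI[of _ "\<lambda>x. if x = 0 then DMtop else DMbot"])
  hence t: "({Var 0}, Var 1) \<notin> minus_logic CL" by (simp add: minus_logic_iff)
  have t': "({Var 0}, Var 1) \<in> almost_trivial" using cf by (simp add: almost_trivial_def)
  have "minus_logic LP \<noteq> minus_logic ?J" "minus_logic LP \<noteq> minus_logic CL"
    "minus_logic LP \<noteq> almost_trivial" using e e' by auto
  moreover have "minus_logic ?J \<noteq> minus_logic CL" "minus_logic ?J \<noteq> almost_trivial"
    using d d' by auto
  moreover have "minus_logic CL \<noteq> almost_trivial" using t t' by auto
  ultimately show ?thesis by simp
qed

theorem theorem7p3:
  shows "{L. is_extension Fm_cf (cf_fragment BD) L \<and>
             \<not> (\<exists>L'. is_extension Fm BD L' \<and> L = cf_fragment L')} =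
         {minus_logic LP, minus_logic (logic_join Fm LP ECQ), minus_logic CL, almost_trivial}
       \<and> card {minus_logic LP, minus_logic (logic_join Fm LP ECQ), minus_logic CL,
               almost_trivial} = 4"
proof (intro conjI four_logics_distinct equalityI subsetI)
  fix L
  assume "L \<in> {L. is_extension Fm_cf (cf_fragment BD) L \<and>
    \<not> (\<exists>L'. is_extension Fm BD L' \<and> L = cf_fragment L')}"
  thus "L \<in> {minus_logic LP, minus_logic (logic_join Fm LP ECQ), minus_logic CL, almost_trivial}"
    using nonfragment_extension_bounds[of L] theoremless_extensions_of_LP[of L]
    unfolding is_extension_def mem_Collect_eq by (elim conjE) metis
next
  fix L
  assume "L \<in> {minus_logic LP, minus_logic (logic_join Fm LP ECQ), minus_logic CL, almost_trivial}"
  moreover have "is_logic Fm UNIV" by (rule is_logicI) (auto simp: Fm_def)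
  ultimately obtain M where "L = minus_logic M" "is_logic Fm M" "LP \<subseteq> M"
    using is_logic_LP is_logic_logic_join LP_subset_join is_logic_CL LP_subset_CL
    unfolding almost_trivial_eq_minus_logic by blast
  thus "L \<in> {L. is_extension Fm_cf (cf_fragment BD) L \<and>
    \<not> (\<exists>L'. is_extension Fm BD L' \<and> L = cf_fragment L')}"
    using minus_logic_nonfragment[of M] by simp
qed

end
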